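(* Let $\mathbb{D}\in\mathbb{R}^{M\times M}$ satisfy $\mathbb{D}+\mathbb{D}^T\le 0$, let $\mathbf{Y}_0\in\mathbb{R}^M$, $\mathbf{R}\in[L^2(0,T)]^M$, and let $r\ge 1$ be an integer. Then the problem of finding $\mathbf{Y}_r\in\mathbf{V}_\tau^r$ such that $\mathbf{Y}_r(0)=\mathbf{Y}_0$ and $$\mathbf{Y}_r'=\mathbb{D}\,\mathcal{P}_{r-1}\mathbf{Y}_r+\mathcal{P}_{r-1}\mathbf{R}\quad\text{in } I_n,\quad 0\le n\le N-1,$$ has a unique solution, and it satisfies $$\max_{1\le n\le N}\|\mathbf{Y}_r(t_n)\|_{\mathbb{R}^M}\le \|\mathbf{Y}_0\|_{\mathbb{R}^M}+CT^{1/2}\|\mathbf{R}\|_{L^2(0,T)},$$ $$\max_{0\le t\le T}\|\mathbf{Y}_r(t)\|_{\mathbb{R}^M}\le Cr^2\left(\|\mathbf{Y}_0\|_{\mathbb{R}^M}+T^{1/2}\|\mathbf{R}\|_{L^2(0,T)}\right),$$ where the constant $C$ is independent of $r,\tau,\mathbb{D}$ and $\mathbf{R}$.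
   Context: $T>0$; $M\ge 1$; $\mathbb{D}+\mathbb{D}^T\le 0$ means negative semidefinite. $0=t_0<t_1<\cdots<t_N=T$ is a partition, $I_n=(t_n,t_{n+1})$, $\tau_n=t_{n+1}-t_n$, $\tau=\max_{0\le n\le N-1}\tau_n$. $P^m$ is the set of polynomials of degree at most $m$. $\mathbf{V}_\tau^m$ ($m\ge 1$) is the space of continuous functions $\mathbf{v}:[0,T]\to\mathbb{R}^M$ with $\mathbf{v}|_{I_n}\in[P^m]^M$ for all $0\le n\le N-1$. For $m\ge 0$, $\mathcal{P}_m$ is the local $L^2$ projection: on each $I_n$, $\mathcal{P}_m\mathbf{v}\in[P^m]^M$ and $\int_{I_n}(\mathcal{P}_m\mathbf{v},\mathbf{w})\,dt=\int_{I_n}(\mathbf{v},\mathbf{w})\,dt$ for all $\mathbf{w}\in[P^m]^M$, where $(\cdot,\cdot)$ is the Euclidean inner product of $\mathbb{R}^M$ and $\|\cdot\|_{\mathbb{R}^M}$ the Euclidean norm. As usual, the generic constant $C$ does not depend on the data $\mathbf{Y}_0,\mathbf{R}$ or on the solution. *)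

theory Defs
  imports "HOL-Analysis.Analysis" "HOL-Computational_Algebra.Polynomial"
begin

definition neg_semidef :: "real ^ 'm ^ 'm \<Rightarrow> bool" where
  "neg_semidef A \<longleftrightarrow> transpose A = A \<and> (\<forall>x. x \<bullet> (A *v x) \<le> 0)"

definition L2_on :: "real set \<Rightarrow> (real \<Rightarrow> 'a::euclidean_space) set" where
  "L2_on S = {f. set_borel_measurable lebesgue S f \<and>
                 set_integrable lebesgue S (\<lambda>s. (norm (f s))\<^sup>2)}"

definition L2_norm_on :: "real set \<Rightarrow> (real \<Rightarrow> 'a::euclidean_space) \<Rightarrow> real" where
  "L2_norm_on S f = sqrt (LINT s:S|lebesgue. (norm (f s))\<^sup>2)"

definition time_partition :: "real \<Rightarrow> nat \<Rightarrow> (nat \<Rightarrow> real) \<Rightarrow> bool" where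
  "time_partition T N t \<longleftrightarrow> t 0 = 0 \<and> t N = T \<and> (\<forall>n<N. t n < t (Suc n))"

abbreviation cell :: "(nat \<Rightarrow> real) \<Rightarrow> nat \<Rightarrow> real set" where
  "cell t n \<equiv> {t n<..<t (Suc n)}"

(* The elements of [P^m]^M as functions on the whole real line; restrictions to a cell are
   expressed by agreement on that cell. *)
definition vec_polys :: "nat \<Rightarrow> (real \<Rightarrow> real ^ 'm) set" where
  "vec_polys m = {p. \<exists>q :: 'm \<Rightarrow> real poly.
     (\<forall>i. degree (q i) \<le> m) \<and> (\<forall>s i. p s $ i = poly (q i) s)}"

(* Functions are only relevant on {0..T}: two members agreeing there are the same element of
   the space. *)
definition V_space :: "real \<Rightarrow> nat \<Rightarrow> (nat \<Rightarrow> real) \<Rightarrow> nat \<Rightarrow> (real \<Rightarrow> real ^ 'm) set" where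
  "V_space T N t m = {v. continuous_on {0..T} v \<and>
     (\<forall>n<N. \<exists>p\<in>vec_polys m. \<forall>s\<in>cell t n. v s = p s)}"

(* The L2 projection onto [P^m]^M over a single interval S, as a polynomial on the real line.
   For S an open interval and v square integrable on S it is well defined, see L2_proj_ex1. *)
definition L2_proj :: "nat \<Rightarrow> real set \<Rightarrow> (real \<Rightarrow> real ^ 'm) \<Rightarrow> real \<Rightarrow> real ^ 'm" where
  "L2_proj m S v = (THE p. p \<in> vec_polys m \<and>
     (\<forall>w\<in>vec_polys m. (LINT s:S|lebesgue. p s \<bullet> w s) = (LINT s:S|lebesgue. v s \<bullet> w s)))"

(* On the n-th cell the local projection of a function is L2_proj over cell t n.  The derivative
   is the classical one, Y being polynomial on each open cell. *)
definition is_solution ::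
  "real \<Rightarrow> nat \<Rightarrow> (nat \<Rightarrow> real) \<Rightarrow> nat \<Rightarrow> real ^ 'm ^ 'm \<Rightarrow> real ^ 'm \<Rightarrow> (real \<Rightarrow> real ^ 'm)
    \<Rightarrow> (real \<Rightarrow> real ^ 'm) \<Rightarrow> bool" where
  "is_solution T N t r D Y0 R Y \<longleftrightarrow>
     Y \<in> V_space T N t r \<and> Y 0 = Y0 \<and>
     (\<forall>n<N. \<forall>s\<in>cell t n.
        (Y has_vector_derivative
           (D *v L2_proj (r - 1) (cell t n) Y s + L2_proj (r - 1) (cell t n) R s)) (at s))"

lemma set_integrable_poly:
  "set_integrable lebesgue {a<..<b::real} (poly p)" for p :: "real poly"
proof -
  have "set_integrable lborel {a..b} (poly p)"
    by (intro borel_integrable_atLeastAtMost') (intro continuous_intros)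
  then have "set_integrable lborel {a<..<b} (poly p)"
    by (rule set_integrable_subset) auto
  then show ?thesis
    unfolding set_integrable_def
    using borel_measurable_integrable integrable_completion by blast
qed

definition poly_int :: "real \<Rightarrow> real \<Rightarrow> real poly \<Rightarrow> real" where
  "poly_int a b p = (LINT s:{a<..<b}|lebesgue. poly p s)"

lemma poly_int_add: "poly_int a b (p + q) = poly_int a b p + poly_int a b q"
  unfolding poly_int_def poly_add by (intro set_integral_add set_integrable_poly)

lemma poly_int_smult: "poly_int a b (smult c p) = c * poly_int a b p"
  unfolding poly_int_def poly_smult by simp

lemma poly_int_diff: "poly_int a b (p - q) = poly_int a b p - poly_int a b q"
  unfolding poly_int_def poly_diff by (intro set_integral_diff set_integrable_poly)

lemma poly_int_square_eq_0:
  assumes "a < b" and "poly_int a b (q * q) = 0"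
  shows "q = 0"
proof (rule ccontr)
  assume "q \<noteq> 0"
  let ?f = "\<lambda>s. indicator {a<..<b} s *\<^sub>R poly (q * q) s"
  have i: "integrable lebesgue ?f"
    using set_integrable_poly[of a b "q * q"] unfolding set_integrable_def .
  have "AE s in lebesgue. ?f s = 0"
    using assms(2) integral_nonneg_eq_0_iff_AE[OF i]
    unfolding poly_int_def set_lebesgue_integral_def by simp
  moreover have "AE s in lebesgue. s \<notin> {s. poly q s = 0}"
    using poly_roots_finite[OF \<open>q \<noteq> 0\<close>]
    by (intro AE_not_in) (simp add: negligible_finite flip: negligible_iff_null_sets)
  ultimately have "AE s in lebesgue. s \<notin> {a<..<b}"
    by eventually_elim (auto simp: indicator_def)
  then have "{a<..<b} \<in> null_sets lebesgue"
    by (subst (asm) AE_iff_null_sets[symmetric]) auto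
  then have "emeasure lebesgue {a<..<b} = 0" by auto
  then show False using assms(1) by simp
qed

lemma poly_riesz:
  fixes L :: "real poly \<Rightarrow> real"
  assumes ab: "a < b"
    and "\<And>p q. L (p + q) = L p + L q" "\<And>c p. L (smult c p) = c * L p"
  shows "\<exists>q. (\<forall>k\<ge>n. coeff q k = 0) \<and>
             (\<forall>w. (\<forall>k\<ge>n. coeff w k = 0) \<longrightarrow> poly_int a b (q * w) = L w)"
  using assms(2,3)
proof (induction n arbitrary: L)
  case 0
  have "L 0 = 0" using "0.prems"(2)[of 0 0] by simp
  moreover have "w = 0" if "\<forall>k\<ge>0. coeff w k = 0" for w :: "real poly"
    using that by (intro poly_eqI) simp
  ultimately show ?case
    by (intro exI[of _ 0]) (fastforce simp: poly_int_def set_lebesgue_integral_def)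
next
  case (Suc n)
  obtain q0 where q0: "\<forall>k\<ge>n. coeff q0 k = 0"
      "\<And>w. (\<forall>k\<ge>n. coeff w k = 0) \<Longrightarrow> poly_int a b (q0 * w) = poly_int a b (monom 1 n * w)"
    using Suc.IH[of "\<lambda>w. poly_int a b (monom 1 n * w)"]
    by (auto simp: distrib_left poly_int_add poly_int_smult)
  define e where "e = monom 1 n - q0"
  have en: "coeff e n = 1" "\<And>k. k \<ge> Suc n \<Longrightarrow> coeff e k = 0"
    using q0(1) by (auto simp: e_def)
  have e_orth: "poly_int a b (e * w) = 0" if "\<forall>k\<ge>n. coeff w k = 0" for w
    using q0(2)[OF that] by (simp add: e_def left_diff_distrib poly_int_diff)
  have ee: "poly_int a b (e * e) \<noteq> 0"
    using poly_int_square_eq_0[OF ab, of e] en(1) by auto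
  obtain q1 where q1: "\<forall>k\<ge>n. coeff q1 k = 0"
      "\<And>w. (\<forall>k\<ge>n. coeff w k = 0) \<Longrightarrow> poly_int a b (q1 * w) = L w"
    using Suc.IH[OF Suc.prems] by auto
  define c where "c = L e / poly_int a b (e * e)"
  show ?case
  proof (intro exI[of _ "q1 + smult c e"] conjI allI impI)
    fix k assume "k \<ge> Suc n"
    then show "coeff (q1 + smult c e) k = 0" using q1(1) en(2) by simp
  next
    fix w :: "real poly" assume w: "\<forall>k\<ge>Suc n. coeff w k = 0"
    define d where "d = coeff w n"
    define w' where "w' = w - smult d e"
    have w': "\<forall>k\<ge>n. coeff w' k = 0"
    proof (intro allI impI)
      fix k assume "n \<le> k"
      then consider "k = n" | "k \<ge> Suc n" by linarith
      then show "coeff w' k = 0"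
        using w en by cases (auto simp: w'_def d_def)
    qed
    have weq: "w = w' + smult d e" by (simp add: w'_def)
    have "poly_int a b (q1 * e) = 0"
      using e_orth[OF q1(1)] by (simp add: mult.commute)
    then have "poly_int a b ((q1 + smult c e) * w) = L w' + c * (d * poly_int a b (e * e))"
      unfolding weq
      by (simp add: distrib_left distrib_right poly_int_add poly_int_smult q1(2)[OF w'] e_orth[OF w'])
    also have "\<dots> = L w"
      using ee by (subst weq) (simp add: Suc.prems c_def)
    finally show "poly_int a b ((q1 + smult c e) * w) = L w" .
  qed
qed

lemma L2_on_times_poly_integrable:
  fixes v :: "real \<Rightarrow> real ^ 'm"
  assumes "v \<in> L2_on {a<..<b}"
  shows "set_integrable lebesgue {a<..<b} (\<lambda>s. v s $ i * poly w s)"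
proof -
  have m: "set_borel_measurable lebesgue {a<..<b} v"
    and i2: "set_integrable lebesgue {a<..<b} (\<lambda>s. (norm (v s))\<^sup>2)"
    using assms by (auto simp: L2_on_def)
  have mi: "(\<lambda>s. indicator {a<..<b} s * v s $ i) \<in> borel_measurable lebesgue"
  proof -
    have "(\<lambda>s. (indicator {a<..<b} s *\<^sub>R v s) \<bullet> axis i 1) \<in> borel_measurable lebesgue"
      using m unfolding set_borel_measurable_def by (intro borel_measurable_inner) auto
    then show ?thesis by (simp add: inner_axis)
  qed
  have mw: "(\<lambda>s. indicator {a<..<b} s * poly w s) \<in> borel_measurable lebesgue"
    using set_integrable_poly[of a b w] unfolding set_integrable_def
    by (auto dest: borel_measurable_integrable)
  have dom: "set_integrable lebesgue {a<..<b} (\<lambda>s. (norm (v s))\<^sup>2 + poly (w * w) s)"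
    by (intro set_integral_add i2 set_integrable_poly)
  have "(\<lambda>s. (indicator {a<..<b} s * v s $ i) * (indicator {a<..<b} s * poly w s))
          \<in> borel_measurable lebesgue"
    using mi mw by (rule borel_measurable_times)
  also have "(\<lambda>s. (indicator {a<..<b} s * v s $ i) * (indicator {a<..<b} s * poly w s)) =
             (\<lambda>s. indicator {a<..<b} s *\<^sub>R (v s $ i * poly w s))"
    by (auto simp: indicator_def)
  finally have meas: "(\<lambda>s. indicator {a<..<b} s *\<^sub>R (v s $ i * poly w s))
          \<in> borel_measurable lebesgue" .
  have bnd: "\<bar>v s $ i * poly w s\<bar> \<le> (norm (v s))\<^sup>2 + poly (w * w) s" for s
  proof -
    have "\<bar>v s $ i * poly w s\<bar> \<le> norm (v s) * \<bar>poly w s\<bar>"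
      by (simp add: abs_mult component_le_norm_cart mult_right_mono)
    also have "\<dots> \<le> (norm (v s))\<^sup>2 + \<bar>poly w s\<bar>\<^sup>2"
      using sum_squares_bound[of "norm (v s)" "\<bar>poly w s\<bar>"]
        mult_nonneg_nonneg[OF norm_ge_zero[of "v s"] abs_ge_zero[of "poly w s"]] by linarith
    finally show ?thesis by (simp add: power2_eq_square)
  qed
  show ?thesis
    unfolding set_integrable_def
    by (rule Bochner_Integration.integrable_bound[OF dom[unfolded set_integrable_def] meas])
       (use bnd in \<open>auto simp: indicator_def intro!: AE_I2 order_trans[OF bnd] \<close>)
qed

lemma vec_polys_inner_integral:
  fixes v :: "real \<Rightarrow> real ^ 'm"
  assumes "\<And>i w. set_integrable lebesgue S (\<lambda>s. v s $ i * poly w s)"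
  shows "(LINT s:S|lebesgue. v s \<bullet> (\<chi> i. poly (u i) s)) =
         (\<Sum>i\<in>UNIV. LINT s:S|lebesgue. v s $ i * poly (u i) s)"
proof -
  have "(LINT s:S|lebesgue. v s \<bullet> (\<chi> i. poly (u i) s)) =
        (LINT s:S|lebesgue. \<Sum>i\<in>UNIV. v s $ i * poly (u i) s)"
    by (simp add: inner_vec_def)
  also have "\<dots> = (\<Sum>i\<in>UNIV. LINT s:S|lebesgue. v s $ i * poly (u i) s)"
    using assms unfolding set_lebesgue_integral_def set_integrable_def scaleR_sum_right
    by (intro Bochner_Integration.integral_sum)
  finally show ?thesis .
qed

lemma vec_polys_alt:
  "vec_polys m = {p. \<exists>q :: 'm::finite \<Rightarrow> real poly.
     (\<forall>i. degree (q i) \<le> m) \<and> p = (\<lambda>s. \<chi> i. poly (q i) s)}"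
  unfolding vec_polys_def by (auto simp: fun_eq_iff vec_eq_iff)

lemma L2_proj_ex1:
  fixes v :: "real \<Rightarrow> real ^ 'm"
  assumes ab: "a < b" and v: "v \<in> L2_on {a<..<b}"
  shows "\<exists>!p. p \<in> vec_polys m \<and>
     (\<forall>w\<in>vec_polys m. (LINT s:{a<..<b}|lebesgue. p s \<bullet> w s) =
                       (LINT s:{a<..<b}|lebesgue. v s \<bullet> w s))"
proof -
  let ?I = "{a<..<b}"
  note vi = L2_on_times_poly_integrable[OF v]
  have pi: "set_integrable lebesgue ?I (\<lambda>s. (\<chi> i. poly (q i) s) $ j * poly w s)"
    for q :: "'m \<Rightarrow> real poly" and j w
    using set_integrable_poly[of a b "q j * w"] by (simp add: set_integrable_def)
  have pint: "(LINT s:?I|lebesgue. (\<chi> i. poly (q i) s) \<bullet> (\<chi> i. poly (u i) s)) =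
              (\<Sum>i\<in>UNIV. poly_int a b (q i * u i))" for q u :: "'m \<Rightarrow> real poly"
    by (subst vec_polys_inner_integral[OF pi]) (simp add: poly_int_def)
  have "\<exists>q. (\<forall>k\<ge>Suc m. coeff q k = 0) \<and> (\<forall>w. (\<forall>k\<ge>Suc m. coeff w k = 0) \<longrightarrow>
          poly_int a b (q * w) = (LINT s:?I|lebesgue. v s $ i * poly w s))" for i
    by (rule poly_riesz[OF ab]) (simp_all add: distrib_left set_integral_add vi mult.left_commute)
  then obtain q where q: "\<And>i k. k \<ge> Suc m \<Longrightarrow> coeff (q i) k = 0"
    "\<And>i w. (\<forall>k\<ge>Suc m. coeff w k = 0) \<Longrightarrow>
       poly_int a b (q i * w) = (LINT s:?I|lebesgue. v s $ i * poly w s)"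
    by metis
  have dq: "degree (q i) \<le> m" for i by (rule degree_le) (use q(1) in auto)
  show ?thesis
  proof (rule ex1I[of _ "\<lambda>s. \<chi> i. poly (q i) s"], intro conjI ballI)
    show "(\<lambda>s. \<chi> i. poly (q i) s) \<in> vec_polys m"
      unfolding vec_polys_alt using dq by auto
  next
    fix w :: "real \<Rightarrow> real ^ 'm" assume "w \<in> vec_polys m"
    then obtain u :: "'m \<Rightarrow> real poly"
      where u: "\<And>i. degree (u i) \<le> m" "w = (\<lambda>s. \<chi> i. poly (u i) s)"
      unfolding vec_polys_alt by auto
    have "\<And>i. \<forall>k\<ge>Suc m. coeff (u i) k = 0"
      using u(1) by (meson Suc_le_eq coeff_eq_0 le_less_trans)
    then show "(LINT s:?I|lebesgue. (\<chi> i. poly (q i) s) \<bullet> w s) = (LINT s:?I|lebesgue. v s \<bullet> w s)"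
      unfolding u(2) pint by (subst vec_polys_inner_integral[OF vi]) (simp add: q(2))
  next
    fix p :: "real \<Rightarrow> real ^ 'm"
    assume p: "p \<in> vec_polys m \<and> (\<forall>w\<in>vec_polys m. (LINT s:?I|lebesgue. p s \<bullet> w s) =
                                                     (LINT s:?I|lebesgue. v s \<bullet> w s))"
    then obtain u :: "'m \<Rightarrow> real poly"
      where u: "\<And>i. degree (u i) \<le> m" "p = (\<lambda>s. \<chi> i. poly (u i) s)"
      unfolding vec_polys_alt by auto
    define e where "e i = u i - q i" for i
    have de: "degree (e i) \<le> m" for i
      unfolding e_def using u(1) dq by (rule degree_diff_le)
    have ce: "\<forall>k\<ge>Suc m. coeff (e i) k = 0" for i
      using de[of i] by (meson Suc_le_eq coeff_eq_0 le_less_trans)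
    have ev: "(\<lambda>s. \<chi> i. poly (e i) s) \<in> vec_polys m"
      unfolding vec_polys_alt using de by auto
    have "(\<Sum>i\<in>UNIV. poly_int a b (u i * e i)) =
                 (LINT s:?I|lebesgue. v s \<bullet> (\<chi> i. poly (e i) s))"
      unfolding pint[symmetric] by (rule bspec[OF conjunct2[OF p[unfolded u(2)]] ev])
    also have "\<dots> = (\<Sum>i\<in>UNIV. poly_int a b (q i * e i))"
      by (subst vec_polys_inner_integral[OF vi]) (simp add: q(2)[OF ce])
    finally have "(\<Sum>i\<in>UNIV. poly_int a b (e i * e i)) = 0"
      unfolding e_def by (simp add: left_diff_distrib poly_int_diff sum_subtractf)
    moreover have "poly_int a b (e i * e i) \<ge> 0" for i
      unfolding poly_int_def set_lebesgue_integral_def by (intro integral_nonneg_AE) auto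
    ultimately have "poly_int a b (e i * e i) = 0" for i
      by (simp add: sum_nonneg_eq_0_iff)
    then have "e i = 0" for i by (rule poly_int_square_eq_0[OF ab])
    then show "p = (\<lambda>s. \<chi> i. poly (q i) s)"
      unfolding u(2) e_def by simp
  qed
qed

end

theory Submission
  imports Defs
begin

text \<open>On a cell \<open>(a, b)\<close> of length \<open>\<tau>\<close> write \<open>U = P Y\<close> for the projection of the solution and
  \<open>E = Y - U\<close>, which is orthogonal to all polynomials of degree less than \<open>r\<close>. Testing the equation
  with \<open>U\<close> gives \<open>|Y(b)|\<^sup>2 \<le> |Y(a)|\<^sup>2 + 2 \<parallel>R\<parallel> \<parallel>U\<parallel>\<close>. Testing it with \<open>(b - s) U\<close> (the matrix
  term keeps its sign) and integrating by parts, where orthogonality of \<open>E\<close> removes the mixed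
  integrals, gives \<open>\<parallel>U\<parallel>\<^sup>2 + \<tau> |E(a)|\<^sup>2 \<le> \<tau> |Y(a)|\<^sup>2 + 2 \<tau> \<parallel>R\<parallel> \<parallel>U\<parallel>\<close>, hence
  \<open>\<parallel>U\<parallel> \<le> sqrt \<tau> |Y(a)| + 2 \<tau> \<parallel>R\<parallel>\<close> and \<open>|Y(b)| \<le> |Y(a)| + 2 sqrt \<tau> \<parallel>R\<parallel>\<close>. Summing over the cells
  with the Cauchy-Schwarz inequality bounds the nodal values. Since \<open>\<tau> |E(a)|\<^sup>2 = (2 r + 1) \<parallel>E\<parallel>\<^sup>2\<close>,
  the same estimate controls \<open>\<parallel>Y\<parallel>\<close>, and an inverse inequality for polynomials turns this into a
  bound for the maximum, even with \<open>r\<close> in place of \<open>r\<^sup>2\<close>. The estimates give uniqueness on each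
  cell, and existence follows because the cell problem is a finite linear system.\<close>

subsection \<open>Integrals and projections of real polynomials\<close>

text \<open>Over the closed interval the gauge integral offers the fundamental theorem of calculus
  and monotonicity in the domain.\<close>

lemma poly_int_altdef: "poly_int a b p = integral {a..b} (poly p)"
  using set_lebesgue_integral_eq_integral(2)[OF set_integrable_poly, of a b p]
  by (simp add: poly_int_def integral_open_interval_real)

lemma poly_int_pderiv:
  assumes "a \<le> b"
  shows "poly_int a b (pderiv p) = poly p b - poly p a"
  unfolding poly_int_altdef
  by (intro integral_unique fundamental_theorem_of_calculus assms)
     (auto simp: has_real_derivative_iff_has_vector_derivative[symmetric]
           intro: poly_DERIV[THEN has_field_derivative_at_within])

lemma poly_int_0 [simp]: "poly_int a b 0 = 0"
  by (simp add: poly_int_def)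

lemma poly_int_mono:
  assumes "\<And>s. a < s \<Longrightarrow> s < b \<Longrightarrow> poly p s \<le> poly q s"
  shows "poly_int a b p \<le> poly_int a b q"
  unfolding poly_int_def by (intro set_integral_mono set_integrable_poly) (use assms in auto)

lemma poly_int_square_nonneg: "poly_int a b (p * p) \<ge> 0"
  using poly_int_mono[of a b 0 "p * p"] by simp

lemma poly_int_sum: "poly_int a b (\<Sum>i\<in>A. f i) = (\<Sum>i\<in>A. poly_int a b (f i))"
  by (induction A rule: infinite_finite_induct) (simp_all add: poly_int_add)

lemma poly_int_const: "a \<le> b \<Longrightarrow> poly_int a b [:c:] = (b - a) * c"
  using poly_int_pderiv[of a b "[:0, c:]"] by (simp add: pderiv_pCons algebra_simps)

lemma poly_int_subinterval:
  assumes "a \<le> c" "d \<le> b"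
  shows "poly_int c d (p * p) \<le> poly_int a b (p * p)"
  unfolding poly_int_altdef
  by (rule integral_subset_le)
     (use assms in \<open>auto intro!: integrable_continuous_real continuous_intros\<close>)

text \<open>The squared difference vanishes on the interval, so its integral is zero and
  definiteness of \<open>poly_int\<close> applies.\<close>

lemma poly_eq_on_interval:
  fixes p q :: "real poly"
  assumes "a < b" "\<And>s. a < s \<Longrightarrow> s < b \<Longrightarrow> poly p s = poly q s"
  shows "p = q"
proof -
  have "poly_int a b ((p - q) * (p - q)) \<le> poly_int a b 0"
    by (rule poly_int_mono) (simp add: assms)
  then have "poly_int a b ((p - q) * (p - q)) = 0"
    using poly_int_square_nonneg[of a b "p - q"] by simp
  then show ?thesis
    using poly_int_square_eq_0[OF assms(1), of "p - q"] by simp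
qed

section \<open>The L2 projection of scalar polynomials\<close>

lemma degree_le_iff_coeff: "degree p \<le> m \<longleftrightarrow> (\<forall>k\<ge>Suc m. coeff p k = 0)"
  by (meson Suc_le_eq coeff_eq_0 degree_le le_less_trans)

definition pproj :: "nat \<Rightarrow> real \<Rightarrow> real \<Rightarrow> real poly \<Rightarrow> real poly" where
  "pproj m a b p = (SOME q. degree q \<le> m \<and>
     (\<forall>w. degree w \<le> m \<longrightarrow> poly_int a b (q * w) = poly_int a b (p * w)))"

lemma pproj:
  assumes "a < b"
  shows degree_pproj: "degree (pproj m a b p) \<le> m"
    and pproj_mult: "degree w \<le> m \<Longrightarrow> poly_int a b (pproj m a b p * w) = poly_int a b (p * w)"
proof -
  have "\<exists>q. degree q \<le> m \<and> (\<forall>w. degree w \<le> m \<longrightarrow> poly_int a b (q * w) = poly_int a b (p * w))"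
    using poly_riesz[OF assms, of "\<lambda>w. poly_int a b (p * w)" "Suc m"]
    by (simp add: degree_le_iff_coeff distrib_left poly_int_add poly_int_smult)
  from someI_ex[OF this] show "degree (pproj m a b p) \<le> m"
    and "degree w \<le> m \<Longrightarrow> poly_int a b (pproj m a b p * w) = poly_int a b (p * w)"
    unfolding pproj_def by blast+
qed

lemma pproj_orth:
  assumes "a < b" "degree w \<le> m"
  shows "poly_int a b ((p - pproj m a b p) * w) = 0"
  using pproj_mult[OF assms] by (simp add: left_diff_distrib poly_int_diff)

text \<open>The difference of two candidates is itself an admissible test function, hence orthogonal
  to itself. Linearity and invariance of low degree polynomials follow from this
  characterization.\<close>

lemma pproj_unique:
  assumes "a < b" "degree q \<le> m"
    and "\<And>w. degree w \<le> m \<Longrightarrow> poly_int a b (q * w) = poly_int a b (p * w)"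
  shows "pproj m a b p = q"
proof -
  have d: "degree (pproj m a b p - q) \<le> m"
    by (intro degree_diff_le degree_pproj assms)
  have "poly_int a b ((pproj m a b p - q) * (pproj m a b p - q)) = 0"
    using pproj_mult[OF assms(1) d, of p] assms(3)[OF d]
    by (simp add: left_diff_distrib[of "pproj m a b p" q] poly_int_diff)
  then show ?thesis
    using poly_int_square_eq_0[OF assms(1), of "pproj m a b p - q"] by simp
qed

lemma pproj_add: "a < b \<Longrightarrow> pproj m a b (p + q) = pproj m a b p + pproj m a b q"
  by (rule pproj_unique) (simp_all add: degree_add_le degree_pproj pproj_mult distrib_right poly_int_add)

lemma pproj_smult: "a < b \<Longrightarrow> pproj m a b (smult c p) = smult c (pproj m a b p)"
  by (rule pproj_unique)
     (simp_all add: order_trans[OF degree_smult_le] degree_pproj pproj_mult poly_int_smult)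

lemma pproj_diff: "a < b \<Longrightarrow> pproj m a b (p - q) = pproj m a b p - pproj m a b q"
  using pproj_add[of a b m p "smult (-1) q"] pproj_smult[of a b m "-1" q] by simp

lemma pproj_id: "a < b \<Longrightarrow> degree p \<le> m \<Longrightarrow> pproj m a b p = p"
  by (rule pproj_unique) auto

section \<open>Endpoint values and the inverse inequality\<close>

lemma degree_pderiv_le:
  "degree p \<le> Suc m \<Longrightarrow> degree (pderiv p) \<le> m" for p :: "real poly"
  by (simp add: degree_le_iff_coeff coeff_pderiv)

text \<open>Both orientations of the interval are carried along, because
  \<open>inverse_inequality\<close> evaluates at the left end of one subinterval or at the right end
  of another.\<close>

definition endpoints :: "real \<Rightarrow> real \<Rightarrow> real \<Rightarrow> real \<Rightarrow> bool" where
  "endpoints a b c d \<longleftrightarrow> a < b \<and> (c = a \<and> d = b \<or> c = b \<and> d = a)"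

text \<open>The weight \<open>s - d\<close> vanishes at one endpoint only, so that integration by parts produces a
  single boundary value, at the opposite endpoint \<open>c\<close>.\<close>

lemma weighted_parts:
  assumes "endpoints a b c d"
  shows "poly_int a b ([:-d, 1:] * pderiv p * q) + poly_int a b ([:-d, 1:] * p * pderiv q) =
         (b - a) * (poly p c * poly q c) - poly_int a b (p * q)"
proof -
  \<comment> \<open>In either orientation the sign of \<open>c - d\<close> cancels the sign of the
    boundary term, which leaves the factor \<open>b - a\<close>.\<close>
  have "poly_int a b (pderiv ([:-d, 1:] * (p * q))) = (b - a) * (poly p c * poly q c)"
    using assms by (subst poly_int_pderiv) (auto simp: endpoints_def algebra_simps)
  moreover have "pderiv ([:-d, 1:] * (p * q)) =
      [:-d, 1:] * pderiv p * q + [:-d, 1:] * p * pderiv q + p * q"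
    by (simp only: pderiv_mult) (simp add: pderiv_pCons algebra_simps)
  ultimately show ?thesis by (simp add: poly_int_add)
qed

text \<open>Such an \<open>e\<close> is a multiple of the shifted Legendre polynomial of degree m +
  1. The polynomials (s - d) e' and (m + 1) e have the same coefficient in degree m + 1, so their
  difference \<open>h\<close> is orthogonal to \<open>e\<close>; \<open>weighted_parts\<close> with
  both arguments \<open>e\<close> then yields 2 (m + 1) + 1.\<close>

lemma orthogonal_remainder_endpoint:
  assumes ep: "endpoints a b c d" and deg: "degree e \<le> Suc m"
    and orth: "\<And>w. degree w \<le> m \<Longrightarrow> poly_int a b (e * w) = 0"
  shows "(b - a) * (poly e c)\<^sup>2 = (2 * real m + 3) * poly_int a b (e * e)"
proof -
  define h where "h = [:-d, 1:] * pderiv e - smult (real (Suc m)) e"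
  have "degree h \<le> m"
  proof (unfold degree_le_iff_coeff, intro allI impI)
    fix k assume "k \<ge> Suc m"
    then obtain j where j: "k = Suc j" "j \<ge> m" by (cases k) auto
    have "coeff e k = 0" if "j > m" using that deg j by (intro coeff_eq_0) simp
    moreover have "coeff e (Suc k) = 0" using deg j by (intro coeff_eq_0) simp
    ultimately show "coeff h k = 0"
      using j by (cases "j = m") (simp_all add: h_def coeff_pderiv)
  qed
  then have "poly_int a b (e * h) = 0" by (rule orth)
  moreover have "[:-d, 1:] * pderiv e * e = e * h + smult (real (Suc m)) (e * e)"
    by (simp add: h_def algebra_simps)
  ultimately have "poly_int a b ([:-d, 1:] * pderiv e * e) = real (Suc m) * poly_int a b (e * e)"
    by (simp only: poly_int_add poly_int_smult)
  moreover have "[:-d, 1:] * e * pderiv e = [:-d, 1:] * pderiv e * e"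
    by (simp only: ac_simps)
  ultimately show ?thesis
    using weighted_parts[OF ep, of e e]
    by (simp add: power2_eq_square algebra_simps del: mult_pCons_left mult_pCons_right)
qed

lemma poly_int_orthogonal_sum:
  assumes "poly_int a b (p * q) = 0"
  shows "poly_int a b ((p + q) * (p + q)) = poly_int a b (p * p) + poly_int a b (q * q)"
proof -
  have "(p + q) * (p + q) = p * p + q * q + (p * q + p * q)"
    by (simp only: distrib_left distrib_right ac_simps)
  then show ?thesis using assms by (simp only: poly_int_add)
qed

text \<open>Splitting off the orthogonal top-degree parts one at a time, the constant is
  \<open>1 + 3 + \<dots> + (2 n + 1) = (n + 1)\<^sup>2\<close>.\<close>

lemma inverse_inequality_endpoint:
  assumes ep: "endpoints a b c d" and "degree p \<le> n"
  shows "(b - a) * (poly p c)\<^sup>2 \<le> (real (Suc n))\<^sup>2 * poly_int a b (p * p)"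
  using assms(2)
proof (induction n arbitrary: p)
  case 0
  then obtain k where "p = [:k:]" by (auto dest: degree0_coeffs)
  then show ?case
    using ep by (simp add: poly_int_const endpoints_def power2_eq_square)
next
  case (Suc n)
  have ab: "a < b" using ep by (simp add: endpoints_def)
  define q where "q = pproj n a b p"
  define e where "e = p - q"
  have dq: "degree q \<le> n" unfolding q_def by (rule degree_pproj[OF ab])
  have orth: "poly_int a b (e * w) = 0" if "degree w \<le> n" for w
    unfolding e_def q_def by (rule pproj_orth[OF ab that])
  have "degree e \<le> Suc n" unfolding e_def using dq Suc.prems by (intro degree_diff_le) auto
  from orthogonal_remainder_endpoint[OF ep this orth]
  have E: "(b - a) * (poly e c)\<^sup>2 = (2 * real n + 3) * poly_int a b (e * e)" .
  have pp: "poly_int a b (p * p) = poly_int a b (q * q) + poly_int a b (e * e)"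
    using poly_int_orthogonal_sum[of a b q e] orth[OF dq]
    by (simp add: e_def mult.commute)
  define x y A B k where "x = poly q c" and "y = poly e c" and "A = poly_int a b (q * q)"
    and "B = poly_int a b (e * e)" and "k = real (Suc n)"
  note IH = Suc.IH[OF dq, folded x_def A_def k_def]
  have k: "k > 0" by (simp add: k_def)
  \<comment> \<open>This is Cauchy-Schwarz, (x + y)^2 <= (k^2 + (2 k + 1)) (x^2 / k^2 + y^2 / (2 k +
    1)), cleared of denominators; the first factor equals (k + 1)^2.\<close>
  have nn: "(b - a) * ((2 * k + 1) * x - k\<^sup>2 * y)\<^sup>2 \<ge> 0" using ab by simp
  have "((2 * k + 1) * k\<^sup>2) * ((b - a) * (x + y)\<^sup>2)
      \<le> ((2 * k + 1) * (k + 1)\<^sup>2) * ((b - a) * x\<^sup>2) + (k\<^sup>2 * (k + 1)\<^sup>2) * ((b - a) * y\<^sup>2)"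
    using nn by (simp add: power2_eq_square algebra_simps)
  also have "(b - a) * y\<^sup>2 = (2 * k + 1) * B"
    using E by (simp add: y_def B_def k_def)
  also have "((2 * k + 1) * (k + 1)\<^sup>2) * ((b - a) * x\<^sup>2) \<le> ((2 * k + 1) * (k + 1)\<^sup>2) * (k\<^sup>2 * A)"
    using k by (intro mult_left_mono IH) simp
  finally have "((2 * k + 1) * k\<^sup>2) * ((b - a) * (x + y)\<^sup>2)
      \<le> ((2 * k + 1) * k\<^sup>2) * ((k + 1)\<^sup>2 * (A + B))"
    by (simp add: algebra_simps)
  moreover have "(2 * k + 1) * k\<^sup>2 > 0" using k by simp
  ultimately have "(b - a) * (x + y)\<^sup>2 \<le> (k + 1)\<^sup>2 * (A + B)"
    by (simp only: mult_le_cancel_left_pos)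
  moreover have "x + y = poly p c" by (simp add: x_def y_def e_def)
  ultimately show ?case
    by (simp add: pp A_def B_def k_def algebra_simps)
qed

text \<open>One of the intervals from \<open>a\<close> to \<open>s\<close> and from \<open>s\<close>
  to \<open>b\<close> has at least half the length, and \<open>s\<close> is an endpoint of it.
  Applying the endpoint inequality there costs the factor 2.\<close>

lemma inverse_inequality:
  assumes ab: "a < b" and s: "s \<in> {a..b}" and deg: "degree p \<le> n"
  shows "(b - a) * (poly p s)\<^sup>2 \<le> 2 * (real (Suc n))\<^sup>2 * poly_int a b (p * p)"
proof -
  define K where "K = (real (Suc n))\<^sup>2 * poly_int a b (p * p)"
  have *: "(b - a) * (poly p s)\<^sup>2 \<le> 2 * K"
    if ep: "endpoints x y s z" and sub: "a \<le> x" "y \<le> b" "(b - a) / 2 \<le> y - x" for x y z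
  proof -
    have "(b - a) * (poly p s)\<^sup>2 \<le> 2 * ((y - x) * (poly p s)\<^sup>2)"
      using mult_right_mono[OF sub(3), of "(poly p s)\<^sup>2"] by (simp add: field_simps)
    also have "\<dots> \<le> 2 * ((real (Suc n))\<^sup>2 * poly_int x y (p * p))"
      using inverse_inequality_endpoint[OF ep deg] by simp
    also have "\<dots> \<le> 2 * K"
      unfolding K_def using poly_int_subinterval[OF sub(1,2), of p]
      by (intro mult_left_mono) auto
    finally show ?thesis .
  qed
  show ?thesis
  proof (cases "s \<le> (a + b) / 2")
    case True
    then show ?thesis
      using *[of s b b] ab s by (simp add: K_def endpoints_def field_simps)
  next
    case False
    then show ?thesis
      using *[of a s a] ab s by (simp add: K_def endpoints_def field_simps)
  qed
qed

subsection \<open>Vectors of polynomials\<close>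

text \<open>The ambient space of polynomial vectors is infinite dimensional, so the dimension count
  takes place inside \<open>S\<close>. A basis of \<open>S\<close> is mapped to an independent set
  of the same size; a vector outside its span would give more independent vectors in
  \<open>S\<close> than the basis allows.\<close>

lemma (in vector_space) injective_imp_surjective_on_subspace:
  assumes lin: "Vector_Spaces.linear scale scale f"
    and S: "subspace S" and T: "finite T" "S \<subseteq> span T"
    and maps: "f ` S \<subseteq> S" and ker: "\<And>x. x \<in> S \<Longrightarrow> f x = 0 \<Longrightarrow> x = 0"
  shows "f ` S = S"
proof -
  interpret f: Vector_Spaces.linear scale scale f by fact
  have inj: "inj_on f S"
  proof (rule inj_onI)
    fix x y assume "x \<in> S" "y \<in> S" "f x = f y"
    then have "x - y = 0" using ker[OF subspace_diff[OF S]] by (simp add: f.diff)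
    then show "x = y" by simp
  qed
  obtain B where B: "B \<subseteq> S" "independent B" "S \<subseteq> span B"
    by (rule maximal_independent_subset)
  have spanB: "span B = S"
    using B(1,3) S by (simp add: span_minimal subset_antisym)
  have finB: "finite B"
    using independent_span_bound[OF T(1) B(2)] B(1) T(2) by auto
  have indep: "independent (f ` B)"
    using f.independent_injective_image[OF B(2)] inj spanB by simp
  have card: "card (f ` B) = card B"
    by (intro card_image inj_on_subset[OF inj B(1)])
  have fB: "f ` B \<subseteq> S" using maps B(1) by blast
  have "S \<subseteq> span (f ` B)"
  proof
    fix v assume v: "v \<in> S"
    show "v \<in> span (f ` B)"
    proof (rule ccontr)
      assume nv: "v \<notin> span (f ` B)"
      have "v \<notin> f ` B" using nv by (metis span_base)
      moreover have "independent (insert v (f ` B))"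
        using nv indep by (rule independent_insertI)
      then have "card (insert v (f ` B)) \<le> card B"
        using independent_span_bound[OF finB, of "insert v (f ` B)"] v fB spanB
        by (metis insert_subset)
      ultimately show False using finB card by simp
    qed
  qed
  also have "span (f ` B) = f ` S" by (simp add: f.span_image spanB)
  finally show ?thesis using maps by blast
qed

text \<open>Polynomial vectors are kept as algebraic objects, so that differentiation, projection
  and the action of \<open>D\<close> act on components; \<open>veval\<close> passes to functions of
  time.\<close>

definition veval :: "(real poly)^'m \<Rightarrow> real \<Rightarrow> real^'m" where
  "veval q s = (\<chi> i. poly (q $ i) s)"

definition vdeg_le :: "nat \<Rightarrow> (real poly)^'m \<Rightarrow> bool" where
  "vdeg_le m q \<longleftrightarrow> (\<forall>i. degree (q $ i) \<le> m)"

definition vip :: "real \<Rightarrow> real \<Rightarrow> (real poly)^'m \<Rightarrow> (real poly)^'m \<Rightarrow> real" where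
  "vip a b q u = (\<Sum>i\<in>UNIV. poly_int a b (q $ i * u $ i))"

definition vproj :: "nat \<Rightarrow> real \<Rightarrow> real \<Rightarrow> (real poly)^'m \<Rightarrow> (real poly)^'m" where
  "vproj m a b q = (\<chi> i. pproj m a b (q $ i))"

definition vderiv :: "(real poly)^'m \<Rightarrow> (real poly)^'m" where
  "vderiv q = (\<chi> i. pderiv (q $ i))"

definition vscale :: "real \<Rightarrow> (real poly)^'m \<Rightarrow> (real poly)^'m" where
  "vscale c q = (\<chi> i. smult c (q $ i))"

definition vmul :: "real poly \<Rightarrow> (real poly)^'m \<Rightarrow> (real poly)^'m" where
  "vmul p q = (\<chi> i. p * q $ i)"

definition vmat :: "real^'m^'n \<Rightarrow> (real poly)^'m \<Rightarrow> (real poly)^'n" where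
  "vmat D q = (\<chi> i. \<Sum>j\<in>UNIV. smult (D $ i $ j) (q $ j))"

definition vconst :: "real^'m \<Rightarrow> (real poly)^'m" where
  "vconst x = (\<chi> i. [:x $ i:])"

lemma vderiv_add: "vderiv (p + q) = vderiv p + vderiv q"
  and vderiv_diff: "vderiv (p - q) = vderiv p - vderiv q"
  and vderiv_vscale: "vderiv (vscale c p) = vscale c (vderiv p)"
  by (simp_all add: vderiv_def vscale_def vec_eq_iff pderiv_add pderiv_diff pderiv_smult)

lemma vproj_add: "a < b \<Longrightarrow> vproj m a b (p + q) = vproj m a b p + vproj m a b q"
  and vproj_diff: "a < b \<Longrightarrow> vproj m a b (p - q) = vproj m a b p - vproj m a b q"
  and vproj_vscale: "a < b \<Longrightarrow> vproj m a b (vscale c p) = vscale c (vproj m a b p)"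
  and vproj_vconst: "a < b \<Longrightarrow> vproj m a b (vconst x) = vconst x"
  by (simp_all add: vproj_def vscale_def vconst_def vec_eq_iff pproj_add pproj_diff pproj_smult
      pproj_id)

lemma smult_sum_right: "smult c (sum f A) = (\<Sum>i\<in>A. smult c (f i))"
  by (induction A rule: infinite_finite_induct) (simp_all add: smult_add_right)

lemma vmat_add: "vmat D (p + q) = vmat D p + vmat D q"
  and vmat_diff: "vmat D (p - q) = vmat D p - vmat D q"
  and vmat_vscale: "vmat D (vscale c p) = vscale c (vmat D p)"
  by (simp_all add: vmat_def vscale_def vec_eq_iff smult_add_right smult_diff_right sum.distrib
      sum_subtractf smult_sum_right mult.commute)

lemma vmul_add: "vmul r (p + q) = vmul r p + vmul r q"
  and vmul_vscale: "vmul r (vscale c p) = vscale c (vmul r p)"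
  by (simp_all add: vmul_def vscale_def vec_eq_iff distrib_left)

lemma vscale_simps:
  "vscale c (p + q) = vscale c p + vscale c q" "vscale c (p - q) = vscale c p - vscale c q"
  "vscale (c + d) p = vscale c p + vscale d p"
  "vscale c (vscale d p) = vscale (c * d) p" "vscale 1 p = p"
  by (simp_all add: vscale_def vec_eq_iff smult_add_right smult_add_left smult_diff_right)

lemma vdeg_le_add: "vdeg_le m p \<Longrightarrow> vdeg_le m q \<Longrightarrow> vdeg_le m (p + q)"
  and vdeg_le_diff: "vdeg_le m p \<Longrightarrow> vdeg_le m q \<Longrightarrow> vdeg_le m (p - q)"
  and vdeg_le_vscale: "vdeg_le m p \<Longrightarrow> vdeg_le m (vscale c p)"
  and vdeg_le_vproj: "a < b \<Longrightarrow> vdeg_le m (vproj m a b p)"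
  and vdeg_le_vderiv: "vdeg_le (Suc m) p \<Longrightarrow> vdeg_le m (vderiv p)"
  and vdeg_le_vconst: "vdeg_le m (vconst x)"
  by (simp_all add: vdeg_le_def vscale_def vproj_def vderiv_def vconst_def degree_add_le
      degree_diff_le degree_pproj degree_pderiv_le order_trans[OF degree_smult_le])

lemma vdeg_le_vmat: "vdeg_le m p \<Longrightarrow> vdeg_le m (vmat D p)"
  by (auto simp: vdeg_le_def vmat_def intro!: degree_sum_le order_trans[OF degree_smult_le])

lemma veval_add: "veval (p + q) s = veval p s + veval q s"
  and veval_diff: "veval (p - q) s = veval p s - veval q s"
  and veval_vmat: "veval (vmat D p) s = D *v veval p s"
  and veval_vconst: "veval (vconst x) s = x"
  by (simp_all add: veval_def vmat_def vconst_def vec_eq_iff poly_sum matrix_vector_mult_def)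

lemma norm_veval: "(norm (veval q s))\<^sup>2 = (\<Sum>i\<in>UNIV. (poly (q $ i) s)\<^sup>2)"
  by (simp add: power2_norm_eq_inner inner_vec_def veval_def) (simp add: power2_eq_square)

lemma veval_eq_on_interval:
  assumes "a < b" "\<And>s. a < s \<Longrightarrow> s < b \<Longrightarrow> veval p s = veval q s"
  shows "p = q"
  using poly_eq_on_interval[OF assms(1)] assms(2)
  by (simp add: vec_eq_iff veval_def)

lemma has_vector_derivative_veval:
  "(veval q has_vector_derivative veval (vderiv q) s) (at s)"
  unfolding has_vector_derivative_def
  by (subst has_derivative_componentwise_within)
     (auto simp: Basis_vec_def inner_axis veval_def vderiv_def mult.commute[of _ "poly _ _"]
      intro: poly_DERIV[unfolded has_field_derivative_def])

lemma continuous_on_veval: "continuous_on S (veval q)"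
  by (intro continuous_at_imp_continuous_on ballI)
     (rule has_vector_derivative_continuous[OF has_vector_derivative_veval])

section \<open>The inner product of polynomial vectors\<close>

lemma vip_nonneg: "vip a b q q \<ge> 0"
  by (simp add: vip_def sum_nonneg poly_int_square_nonneg)

lemma vip_eq_0_iff:
  assumes "a < b"
  shows "vip a b q q = 0 \<longleftrightarrow> q = 0"
  using poly_int_square_eq_0[OF assms]
  by (auto simp: vip_def vec_eq_iff sum_nonneg_eq_0_iff poly_int_square_nonneg)

lemma vip_commute: "vip a b q u = vip a b u q"
  by (simp add: vip_def mult.commute)

lemma vip_diff_left: "vip a b (p - q) u = vip a b p u - vip a b q u"
  by (simp add: vip_def left_diff_distrib poly_int_diff sum_subtractf)

lemma vip_diff_right: "vip a b u (p - q) = vip a b u p - vip a b u q"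
  by (simp add: vip_commute[of a b u] vip_diff_left)

lemma vip_vscale_left: "vip a b (vscale c p) u = c * vip a b p u"
  by (simp add: vip_def vscale_def poly_int_smult sum_distrib_left)

lemma vip_vscale_right: "vip a b u (vscale c p) = c * vip a b u p"
  by (simp add: vip_commute[of a b u] vip_vscale_left)

lemma vip_Cauchy_Schwarz:
  assumes "a < b"
  shows "vip a b q u \<le> sqrt (vip a b q q) * sqrt (vip a b u u)"
proof (cases "u = 0")
  case True
  then have "vip a b q u = 0" by (simp add: vip_def)
  then show ?thesis by (simp add: vip_nonneg)
next
  case False
  define A B K where "A = vip a b q q" and "B = vip a b q u" and "K = vip a b u u"
  have K: "K > 0"
    using vip_nonneg[of a b u] vip_eq_0_iff[OF assms, of u] False by (simp add: K_def)
  \<comment> \<open>The vector is \<open>K\<close> times the part of \<open>q\<close> orthogonal to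
    \<open>u\<close>; the scaling by \<open>K\<close> avoids a division.\<close>
  have "0 \<le> vip a b (vscale K q - vscale B u) (vscale K q - vscale B u)" by (rule vip_nonneg)
  also have "\<dots> = K * (A * K - B * B)"
    unfolding vip_diff_left vip_diff_right vip_vscale_left vip_vscale_right
    by (simp add: vip_commute[of a b u q] A_def B_def K_def algebra_simps)
  finally have "B\<^sup>2 \<le> A * K"
    using K by (simp add: zero_le_mult_iff power2_eq_square)
  then have "B \<le> sqrt (A * K)" by (rule real_le_rsqrt)
  then show ?thesis by (simp add: A_def B_def K_def real_sqrt_mult)
qed

text \<open>On the cell the weight b - s lies between 0 and b - a, so Cauchy-Schwarz loses only the
  factor b - a.\<close>

lemma vip_weighted_le:
  assumes "a < b"
  shows "vip a b q (vmul [:b, -1:] u) \<le> (b - a) * (sqrt (vip a b q q) * sqrt (vip a b u u))"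
proof -
  have *: "(b - s) * x * ((b - s) * x) \<le> (b - a)\<^sup>2 * (x * x)" if "a < s" "s < b" for s x
  proof -
    have "(b - s)\<^sup>2 * (x * x) \<le> (b - a)\<^sup>2 * (x * x)"
      using that by (intro mult_right_mono power_mono) auto
    then show ?thesis by (simp add: power2_eq_square ac_simps)
  qed
  have "poly_int a b (([:b, -1:] * u $ i) * ([:b, -1:] * u $ i)) \<le> (b - a)\<^sup>2 * poly_int a b (u $ i * u $ i)"
    for i
    unfolding poly_int_smult[symmetric]
  proof (rule poly_int_mono)
    fix s assume "a < s" "s < b"
    from *[OF this, of "poly (u $ i) s"]
    show "poly ([:b, -1:] * u $ i * ([:b, -1:] * u $ i)) s
        \<le> poly (smult ((b - a)\<^sup>2) (u $ i * u $ i)) s"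
      by (simp add: left_diff_distrib)
  qed
  then have "vip a b (vmul [:b, -1:] u) (vmul [:b, -1:] u) \<le> (b - a)\<^sup>2 * vip a b u u"
    unfolding vip_def vmul_def sum_distrib_left by (intro sum_mono) simp
  then have "sqrt (vip a b (vmul [:b, -1:] u) (vmul [:b, -1:] u)) \<le> (b - a) * sqrt (vip a b u u)"
    using assms by (metis real_sqrt_le_mono real_sqrt_mult real_sqrt_abs abs_of_pos diff_gt_0_iff_gt)
  then have "sqrt (vip a b q q) * sqrt (vip a b (vmul [:b, -1:] u) (vmul [:b, -1:] u))
      \<le> sqrt (vip a b q q) * ((b - a) * sqrt (vip a b u u))"
    by (intro mult_left_mono) (simp_all add: vip_nonneg)
  with vip_Cauchy_Schwarz[OF assms, of q "vmul [:b, -1:] u"] show ?thesis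
    by (simp add: algebra_simps)
qed

subsection \<open>The problem on a single cell\<close>

text \<open>Split y = u + e. The weight restores the degree lost in u', so e is orthogonal to the
  weighted u' as well as to u. After integration by parts only the norm of u and values at
  \<open>a\<close> remain.\<close>

lemma weighted_parts_projection:
  fixes m y
  assumes ab: "a < b"
  defines "u \<equiv> pproj m a b y"
  shows "2 * poly_int a b ([:b, -1:] * pderiv y * u) =
         poly_int a b (u * u) + (b - a) * (poly (y - u) a)\<^sup>2 - (b - a) * (poly y a)\<^sup>2"
proof -
  define e where "e = y - u"
  define W :: "real poly" where "W = [:-b, 1:]"
  have ep: "endpoints a b a b" using ab by (simp add: endpoints_def)
  have du: "degree u \<le> m" unfolding u_def by (rule degree_pproj[OF ab])
  have orth: "poly_int a b (e * w) = 0" if "degree w \<le> m" for w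
    unfolding e_def u_def by (rule pproj_orth[OF ab that])
  have "degree (W * pderiv u) \<le> m"
  proof (cases "degree u = 0")
    case True
    then show ?thesis by (simp add: pderiv_eq_0_iff[THEN iffD2])
  next
    case False
    have "degree (W * pderiv u) \<le> degree W + degree (pderiv u)" by (rule degree_mult_le)
    also have "\<dots> = degree u" using False by (simp add: W_def degree_pderiv)
    finally show ?thesis using du by simp
  qed
  from orth[OF this] have 1: "poly_int a b (W * e * pderiv u) = 0" by (simp only: ac_simps)
  have uu: "2 * poly_int a b (W * pderiv u * u) = (b - a) * (poly u a)\<^sup>2 - poly_int a b (u * u)"
    using weighted_parts[OF ep, of u u, folded W_def]
    by (simp add: power2_eq_square mult.commute[of "pderiv u"] mult.left_commute[of "pderiv u"] mult.assoc)
  have eu: "poly_int a b (W * pderiv e * u) = (b - a) * (poly e a * poly u a)"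
    using weighted_parts[OF ep, of e u, folded W_def] 1 orth[OF du] by simp
  have y: "y = u + e" by (simp add: e_def)
  have "poly_int a b (W * pderiv y * u) =
      poly_int a b (W * pderiv u * u) + poly_int a b (W * pderiv e * u)"
    unfolding y by (simp only: pderiv_add distrib_left distrib_right poly_int_add)
  moreover have "poly_int a b ([:b, -1:] * pderiv y * u) = - poly_int a b (W * pderiv y * u)"
  proof -
    have "[:b, -1:] = smult (-1) W" by (simp add: W_def)
    then show ?thesis by (simp only: mult_smult_left poly_int_smult mult_minus1)
  qed
  ultimately have "2 * poly_int a b ([:b, -1:] * pderiv y * u) =
      poly_int a b (u * u) - (b - a) * (poly u a)\<^sup>2 - 2 * ((b - a) * (poly e a * poly u a))"
    using uu eu by simp
  \<comment> \<open>The boundary values combine by u(a)^2 + 2 e(a) u(a) = y(a)^2 - e(a)^2.\<close>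
  then show ?thesis
    unfolding e_def[symmetric] y poly_add by (simp add: power2_eq_square algebra_simps)
qed

lemma poly_int_pderiv_projection:
  assumes ab: "a < b" and dy: "degree y \<le> Suc m"
  shows "2 * poly_int a b (pderiv y * pproj m a b y) = (poly y b)\<^sup>2 - (poly y a)\<^sup>2"
proof -
  have "poly_int a b (pderiv y * pproj m a b y) = poly_int a b (y * pderiv y)"
    using pproj_mult[OF ab degree_pderiv_le[OF dy], of y] by (simp add: mult.commute)
  moreover have "poly_int a b (pderiv (y * y)) = (poly y b)\<^sup>2 - (poly y a)\<^sup>2"
    using ab by (subst poly_int_pderiv) (simp_all add: power2_eq_square)
  moreover have "pderiv (y * y) = y * pderiv y + y * pderiv y"
    by (simp only: pderiv_mult ac_simps)
  ultimately show ?thesis by (simp only: poly_int_add)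
qed

section \<open>Energy estimates and uniqueness on one cell\<close>

lemma neg_semidef_quadratic_form:
  assumes "neg_semidef (D + transpose D)"
  shows "x \<bullet> (D *v x) \<le> 0"
proof -
  have "x \<bullet> ((D + transpose D) *v x) = 2 * (x \<bullet> (D *v x))"
    by (simp add: matrix_vector_mult_add_rdistrib inner_add_right dot_lmul_matrix
        vector_transpose_matrix inner_commute flip: dot_matrix_vector_mul)
       (metis dot_lmul_matrix inner_commute vector_transpose_matrix)
  then show ?thesis using assms unfolding neg_semidef_def by (metis mult_le_0_iff not_numeral_le_zero)
qed

text \<open>The differential equation is stated as an identity of polynomials, with m = r - 1 and
  \<open>g\<close> in place of the projected data. The initial value is left out and prescribed
  separately, so that differences of solutions stay within the notion.\<close>

definition cell_solution ::
  "nat \<Rightarrow> real^'m^'m \<Rightarrow> real \<Rightarrow> real \<Rightarrow> (real poly)^'m \<Rightarrow> (real poly)^'m \<Rightarrow> bool" where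
  "cell_solution m D a b g y \<longleftrightarrow>
     vdeg_le (Suc m) y \<and> vderiv y = vmat D (vproj m a b y) + g"

lemma cell_solution_diff:
  assumes "a < b" "cell_solution m D a b g y" "cell_solution m D a b h z"
  shows "cell_solution m D a b (g - h) (y - z)"
  using assms by (simp add: cell_solution_def vdeg_le_diff vderiv_diff vproj_diff vmat_diff)

text \<open>The inner product with \<open>u\<close> is taken at each time: the matrix term is
  nonpositive there, and the nonnegative weight preserves the sign. The weights used later are b - s
  and 1.\<close>

lemma cell_solution_weighted_energy:
  assumes D: "neg_semidef (D + transpose D)" and y: "cell_solution m D a b g y"
    and W: "\<And>s. a < s \<Longrightarrow> s < b \<Longrightarrow> poly W s \<ge> 0"
  defines "u \<equiv> vproj m a b y"
  shows "(\<Sum>i\<in>UNIV. poly_int a b (W * pderiv (y $ i) * u $ i)) \<le> vip a b g (vmul W u)"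
proof -
  have "(\<Sum>i\<in>UNIV. poly_int a b (W * vderiv y $ i * u $ i)) \<le>
        (\<Sum>i\<in>UNIV. poly_int a b (W * g $ i * u $ i))"
    unfolding poly_int_sum[symmetric]
  proof (rule poly_int_mono)
    fix s assume "a < s" "s < b"
    have "veval (vderiv y) s = D *v veval u s + veval g s"
      using y by (simp add: cell_solution_def veval_add veval_vmat u_def)
    then have "veval u s \<bullet> veval (vderiv y) s \<le> veval u s \<bullet> veval g s"
      using neg_semidef_quadratic_form[OF D, of "veval u s"] by (simp add: inner_add_right)
    from mult_left_mono[OF this W[OF \<open>a < s\<close> \<open>s < b\<close>]]
    show "poly (\<Sum>i\<in>UNIV. W * vderiv y $ i * u $ i) s \<le> poly (\<Sum>i\<in>UNIV. W * g $ i * u $ i) s"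
      by (simp add: inner_vec_def veval_def poly_sum sum_distrib_left ac_simps)
  qed
  then show ?thesis by (simp add: vderiv_def vip_def vmul_def mult.left_commute mult.assoc)
qed

lemma cell_solution_bounds:
  assumes ab: "a < b" and D: "neg_semidef (D + transpose D)"
    and y: "cell_solution m D a b g y" and rho: "\<rho> \<ge> 0" "vip a b g g \<le> \<rho>\<^sup>2"
  defines "X \<equiv> norm (veval y a) + 2 * sqrt (b - a) * \<rho>"
  shows "norm (veval y b) \<le> X"
    and "s \<in> {a..b} \<Longrightarrow> norm (veval y s) \<le> 3 * real (Suc m) * X"
proof -
  define u where "u = vproj m a b y"
  define e where "e = y - u"
  define U where "U = sqrt (vip a b u u)"
  define A where "A = norm (veval y a)"
  define \<sigma> where "\<sigma> = sqrt (b - a)"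
  have U: "U \<ge> 0" "U\<^sup>2 = vip a b u u" by (simp_all add: U_def vip_nonneg)
  have \<sigma>: "\<sigma> > 0" "\<sigma>\<^sup>2 = b - a" using ab by (simp_all add: \<sigma>_def)
  have A: "A \<ge> 0" by (simp add: A_def)
  have X: "X = A + 2 * \<sigma> * \<rho>" "X \<ge> 0" using rho ab by (simp_all add: X_def A_def \<sigma>_def)
  have dy: "degree (y $ i) \<le> Suc m" for i using y by (simp add: cell_solution_def vdeg_le_def)
  have g: "sqrt (vip a b g g) \<le> \<rho>" using rho by (simp add: real_le_lsqrt)
  have gU: "sqrt (vip a b g g) * U \<le> \<rho> * U" using g U(1) by (rule mult_right_mono)

  \<comment> \<open>Testing with the weight b - s: the left side is computed exactly, the right side
    is estimated, and the result \<open>B\<close> controls both \<open>U\<close> and the value of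
    \<open>e\<close> at \<open>a\<close>.\<close>
  have "2 * (\<Sum>i\<in>UNIV. poly_int a b ([:b, -1:] * pderiv (y $ i) * u $ i)) =
      U\<^sup>2 + \<sigma>\<^sup>2 * (norm (veval e a))\<^sup>2 - \<sigma>\<^sup>2 * A\<^sup>2"
    unfolding u_def sum_distrib_left U(2)
    by (simp add: vproj_def weighted_parts_projection[OF ab] vip_def norm_veval A_def \<sigma>(2) e_def
        u_def sum.distrib sum_subtractf sum_distrib_left del: mult_pCons_left)
  moreover have "(\<Sum>i\<in>UNIV. poly_int a b ([:b, -1:] * pderiv (y $ i) * u $ i))
      \<le> vip a b g (vmul [:b, -1:] u)"
    unfolding u_def by (rule cell_solution_weighted_energy[OF D y]) simp
  moreover have "vip a b g (vmul [:b, -1:] u) \<le> \<sigma>\<^sup>2 * (\<rho> * U)"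
    using vip_weighted_le[OF ab, of g u] mult_left_mono[OF gU, of "b - a"] ab
    unfolding \<sigma>(2) U_def by linarith
  ultimately have B: "U\<^sup>2 + \<sigma>\<^sup>2 * (norm (veval e a))\<^sup>2 \<le> \<sigma>\<^sup>2 * A\<^sup>2 + 2 * (\<sigma>\<^sup>2 * (\<rho> * U))"
    by linarith

  \<comment> \<open>Otherwise \<open>\<sigma> * A\<close> <= \<open>\<sigma> * X\<close> <
    \<open>U\<close>, so U^2 exceeds \<open>\<sigma> * X * U\<close>, which is at least the right
    side of \<open>B\<close>.\<close>
  have UB: "U \<le> \<sigma> * X"
  proof (rule ccontr)
    assume "\<not> U \<le> \<sigma> * X"
    then have less: "\<sigma> * X < U" by simp
    have "0 < U" using less X(2) \<sigma>(1) by (meson le_less_trans less_imp_le mult_nonneg_nonneg)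
    have "\<sigma> * A \<le> \<sigma> * X" unfolding X(1) using \<sigma> rho by (intro mult_left_mono) auto
    then have "\<sigma> * A \<le> U" using less by linarith
    then have "(\<sigma> * A) * (\<sigma> * A) \<le> U * (\<sigma> * A)" using A \<sigma> by (intro mult_right_mono) auto
    moreover have "U * (\<sigma> * X) < U * U" using less \<open>0 < U\<close> by simp
    moreover have "0 \<le> \<sigma>\<^sup>2 * (norm (veval e a))\<^sup>2" by simp
    ultimately show False using B unfolding X(1) by (simp add: power2_eq_square algebra_simps)
  qed

  \<comment> \<open>With X = A + 2 \<open>\<sigma> * \<rho>\<close> expanded, the two sides differ
    by 2 \<open>A * \<sigma> * \<rho>\<close>.\<close>
  have XX: "A\<^sup>2 + 2 * (\<rho> * (\<sigma> * X)) \<le> X\<^sup>2"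
    unfolding X(1) using A rho(1) \<sigma>(1) by (simp add: power2_eq_square algebra_simps)
  have rU: "\<rho> * U \<le> \<rho> * (\<sigma> * X)" using UB rho(1) by (rule mult_left_mono)

  \<comment> \<open>Testing with the weight 1 brings in the value at \<open>b\<close>.\<close>
  have "2 * (\<Sum>i\<in>UNIV. poly_int a b (1 * pderiv (y $ i) * u $ i)) = (norm (veval y b))\<^sup>2 - A\<^sup>2"
    unfolding u_def sum_distrib_left
    by (simp add: vproj_def poly_int_pderiv_projection[OF ab dy] norm_veval A_def sum_subtractf)
  moreover have "(\<Sum>i\<in>UNIV. poly_int a b (1 * pderiv (y $ i) * u $ i)) \<le> vip a b g (vmul 1 u)"
    unfolding u_def by (rule cell_solution_weighted_energy[OF D y]) simp
  moreover have "vip a b g (vmul 1 u) \<le> \<rho> * U"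
    using vip_Cauchy_Schwarz[OF ab, of g u] gU by (simp add: vmul_def vip_def U_def)
  ultimately have "(norm (veval y b))\<^sup>2 \<le> X\<^sup>2" using rU XX by linarith
  then show "norm (veval y b) \<le> X" using X(2) by (rule power2_le_imp_le)

  assume s: "s \<in> {a..b}"
  \<comment> \<open>\<open>e\<close> is the top Legendre component of \<open>y\<close>, so its norm
    over the cell is determined by its value at \<open>a\<close>, which \<open>B\<close> bounds; the
    factor 2 m + 3 is at least 1.\<close>
  have "endpoints a b a b" using ab by (simp add: endpoints_def)
  then have "(b - a) * (poly (e $ i) a)\<^sup>2 = (2 * real m + 3) * poly_int a b (e $ i * e $ i)" for i
  proof (rule orthogonal_remainder_endpoint)
    show "degree (e $ i) \<le> Suc m"
      using dy[of i] degree_pproj[OF ab, of m "y $ i"]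
      by (simp add: e_def u_def vproj_def degree_diff_le)
    show "poly_int a b (e $ i * w) = 0" if "degree w \<le> m" for w
      using pproj_orth[OF ab that] by (simp add: e_def u_def vproj_def)
  qed
  then have "\<sigma>\<^sup>2 * (norm (veval e a))\<^sup>2 = (2 * real m + 3) * vip a b e e"
    by (simp add: norm_veval vip_def \<sigma>(2) sum_distrib_left)
  moreover have "vip a b e e \<le> (2 * real m + 3) * vip a b e e"
    using mult_right_mono[OF _ vip_nonneg[of a b e], of 1 "2 * real m + 3"] by simp
  moreover have "vip a b y y = U\<^sup>2 + vip a b e e"
  proof -
    have "poly_int a b (u $ i * e $ i) = 0" for i
      using pproj_orth[OF ab degree_pproj[OF ab], of "y $ i" m "y $ i"]
      by (simp add: e_def u_def vproj_def mult.commute)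
    from poly_int_orthogonal_sum[OF this] show ?thesis
      unfolding U(2) by (simp add: vip_def e_def sum.distrib)
  qed
  moreover have "\<sigma>\<^sup>2 * A\<^sup>2 + 2 * (\<sigma>\<^sup>2 * (\<rho> * U)) \<le> \<sigma>\<^sup>2 * X\<^sup>2"
  proof -
    have "A\<^sup>2 + 2 * (\<rho> * U) \<le> X\<^sup>2" using XX rU by linarith
    from mult_left_mono[OF this, of "\<sigma>\<^sup>2"] show ?thesis by (simp add: algebra_simps)
  qed
  ultimately have yy: "vip a b y y \<le> \<sigma>\<^sup>2 * X\<^sup>2" using B by linarith

  have "\<sigma>\<^sup>2 * (norm (veval y s))\<^sup>2 \<le> 2 * (real (Suc (Suc m)))\<^sup>2 * vip a b y y"
    unfolding norm_veval vip_def \<sigma>(2) sum_distrib_left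
    by (intro sum_mono inverse_inequality ab s dy)
  also have "\<dots> \<le> 2 * (real (Suc (Suc m)))\<^sup>2 * (\<sigma>\<^sup>2 * X\<^sup>2)"
    by (intro mult_left_mono yy) simp
  also have "\<dots> \<le> (3 * real (Suc m))\<^sup>2 * (\<sigma>\<^sup>2 * X\<^sup>2)"
  proof -
    \<comment> \<open>Here the constant 3 arises: the tightest case is m = 0, where the inequality
      reads 8 <= 9.\<close>
    have "2 * (real (Suc (Suc m)))\<^sup>2 \<le> (3 * real (Suc m))\<^sup>2"
      by (simp add: power2_eq_square algebra_simps)
    then show ?thesis by (rule mult_right_mono) simp
  qed
  finally have "\<sigma>\<^sup>2 * (norm (veval y s))\<^sup>2 \<le> \<sigma>\<^sup>2 * (3 * real (Suc m) * X)\<^sup>2"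
    by (simp only: power_mult_distrib ac_simps)
  then have "(norm (veval y s))\<^sup>2 \<le> (3 * real (Suc m) * X)\<^sup>2"
    by (rule mult_left_le_imp_le) (use \<sigma>(1) in simp)
  then show "norm (veval y s) \<le> 3 * real (Suc m) * X"
    by (rule power2_le_imp_le) (use X(2) in simp)
qed

text \<open>The difference solves the problem with zero data and zero initial value, so the bound on
  the cell is 0.\<close>

lemma cell_solution_unique:
  assumes ab: "a < b" and D: "neg_semidef (D + transpose D)"
    and y: "cell_solution m D a b g y" and z: "cell_solution m D a b g z"
    and eq: "veval y a = veval z a"
  shows "y = z"
proof -
  have d: "cell_solution m D a b 0 (y - z)"
    using cell_solution_diff[OF ab y z] by simp
  have "vip a b (0 :: (real poly)^'m) 0 \<le> 0\<^sup>2" by (simp add: vip_def)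
  note bd = cell_solution_bounds(2)[OF ab D d order_refl this]
  have "norm (veval (y - z) s) \<le> 0" if "s \<in> {a..b}" for s
    using bd[OF that] by (simp add: veval_diff eq)
  then show "y = z"
    by (intro veval_eq_on_interval[OF ab]) (simp add: veval_diff)
qed

section \<open>Existence on one cell\<close>

interpretation vpoly: vector_space "vscale :: real \<Rightarrow> (real poly)^'m \<Rightarrow> _"
  by unfold_locales (simp_all add: vscale_simps)

lemma subspace_vdeg_le: "vpoly.subspace {q :: (real poly)^'m. vdeg_le m q}"
  by (auto simp: vpoly.subspace_def vdeg_le_add vdeg_le_vscale) (simp add: vdeg_le_def)

text \<open>Supplies the finite spanning set for the dimension count: the monomials placed in single
  components.\<close>

lemma vdeg_le_span:
  "{q :: (real poly)^'m. vdeg_le m q} \<subseteq>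
     vpoly.span ((\<lambda>(i, k). axis i (monom 1 k)) ` (UNIV \<times> {..m}))"
proof
  fix q :: "(real poly)^'m" assume "q \<in> {q. vdeg_le m q}"
  then have "degree (q $ i) \<le> m" for i by (simp add: vdeg_le_def)
  then have *: "(\<Sum>k\<le>m. smult (coeff (q $ i) k) (monom 1 k)) = q $ i" for i
    by (simp add: smult_monom poly_as_sum_of_monoms')
  have "(\<Sum>k\<le>m. vscale (coeff (q $ i) k) (axis i (monom 1 k))) $ j = (if i = j then q $ j else 0)"
    for i j
    using *[of i] by (auto simp: vscale_def axis_def)
  then have "q = (\<Sum>i\<in>UNIV. \<Sum>k\<le>m. vscale (coeff (q $ i) k) (axis i (monom 1 k)))"
    by (simp add: vec_eq_iff del: sum_component) (simp add: sum_component[of _ UNIV])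
  also have "\<dots> \<in> vpoly.span ((\<lambda>(i, k). axis i (monom 1 k)) ` (UNIV \<times> {..m}))"
    by (intro vpoly.span_sum vpoly.span_scale vpoly.span_base) auto
  finally show "q \<in> vpoly.span ((\<lambda>(i, k). axis i (monom 1 k)) ` (UNIV \<times> {..m}))" .
qed

text \<open>Writing \<open>y = y0 + (s - a) z\<close>, the cell problem becomes a square linear system for \<open>z\<close>, so
  that existence follows from uniqueness.\<close>

lemma cell_solution_exists:
  fixes D :: "real^'m^'m"
  assumes ab: "a < b" and D: "neg_semidef (D + transpose D)" and g: "vdeg_le m g"
  shows "\<exists>y. cell_solution m D a b g y \<and> veval y a = y0"
proof -
  let ?S = "{q :: (real poly)^'m. vdeg_le m q}"
  \<comment> \<open>The factor s - a makes the initial value vanish and raises the degree by one, so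
    unknown and right side both range over degree at most \<open>m\<close>.\<close>
  define L :: "(real poly)^'m \<Rightarrow> (real poly)^'m" where "L z = vmul [:-a, 1:] z" for z
  define F where "F z = vderiv (L z) - vmat D (vproj m a b (L z))" for z
  have lin: "Vector_Spaces.linear vscale vscale F"
    by unfold_locales
       (simp_all add: F_def L_def vscale_simps vmul_add vmul_vscale vderiv_add vderiv_vscale
          vproj_add[OF ab] vproj_vscale[OF ab] vmat_add vmat_vscale)
  have dL: "vdeg_le (Suc m) (L z)" if "vdeg_le m z" for z
    unfolding vdeg_le_def
  proof
    fix i
    have "degree (L z $ i) \<le> degree [:-a, 1:] + degree (z $ i)"
      unfolding L_def vmul_def vec_lambda_beta by (rule degree_mult_le)
    then show "degree (L z $ i) \<le> Suc m"
      using that by (auto simp: vdeg_le_def intro: order_trans)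
  qed
  have La: "veval (L z) a = 0" for z by (simp add: L_def vmul_def veval_def vec_eq_iff)
  have maps: "F ` ?S \<subseteq> ?S"
    using dL by (auto simp: F_def intro!: vdeg_le_diff vdeg_le_vderiv vdeg_le_vmat vdeg_le_vproj ab)
  have ker: "z = 0" if "z \<in> ?S" "F z = 0" for z
  proof -
    have sol: "cell_solution m D a b 0 (L z)"
      using that dL by (simp add: cell_solution_def F_def)
    have "cell_solution m D a b 0 (0 :: (real poly)^'m)"
      using cell_solution_diff[OF ab sol sol] by simp
    with sol have "L z = 0"
      by (rule cell_solution_unique[OF ab D]) (simp add: La, simp add: veval_def vec_eq_iff)
    then show "z = 0" by (simp add: L_def vmul_def vec_eq_iff del: mult_pCons_left)
  qed
  have "F ` ?S = ?S"
    by (rule vpoly.injective_imp_surjective_on_subspace[OF lin subspace_vdeg_le _ vdeg_le_span maps ker])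
       auto
  moreover have "g + vmat D (vconst y0) \<in> ?S"
    using g by (simp add: vdeg_le_add vdeg_le_vmat vdeg_le_vconst)
  ultimately obtain z where z: "vdeg_le m z" "F z = g + vmat D (vconst y0)"
    by (metis (no_types, lifting) imageE mem_Collect_eq)
  \<comment> \<open>The constant \<open>y0\<close> has derivative zero and equals its projection, so
    it contributes only \<open>D *v y0\<close>, which was added to the right side.\<close>
  have "vderiv (vconst y0) = 0" by (simp add: vderiv_def vconst_def vec_eq_iff pderiv_pCons)
  then have "cell_solution m D a b g (vconst y0 + L z)"
    using z(2) dL[OF z(1)]
    by (simp add: cell_solution_def vdeg_le_add vdeg_le_vconst vderiv_add vproj_add[OF ab]
        vproj_vconst[OF ab] vmat_add F_def algebra_simps)
  moreover have "veval (vconst y0 + L z) a = y0" by (simp add: veval_add La veval_vconst)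
  ultimately show ?thesis by blast
qed

subsection \<open>The global problem\<close>

lemma vec_polys_eq: "vec_polys m = veval ` {q. vdeg_le m q}"
proof (intro equalityI subsetI)
  fix p :: "real \<Rightarrow> real^'m" assume "p \<in> vec_polys m"
  then obtain q :: "'m \<Rightarrow> real poly" where "\<And>i. degree (q i) \<le> m" "p = (\<lambda>s. \<chi> i. poly (q i) s)"
    unfolding vec_polys_alt by auto
  then show "p \<in> veval ` {q. vdeg_le m q}"
    by (intro image_eqI[of _ _ "\<chi> i. q i"]) (auto simp: veval_def vdeg_le_def fun_eq_iff)
qed (auto simp: vec_polys_def veval_def vdeg_le_def)

lemma set_integrable_veval_component:
  "set_integrable lebesgue {a<..<b} (\<lambda>s. veval q s $ i * poly w s)"
  using set_integrable_poly[of a b "q $ i * w"] by (simp add: veval_def set_integrable_def)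

lemma vip_eq_integral: "vip a b q u = (LINT s:{a<..<b}|lebesgue. veval q s \<bullet> veval u s)"
  unfolding veval_def[of u] vec_polys_inner_integral[OF set_integrable_veval_component]
  by (simp add: vip_def poly_int_def veval_def)

lemma veval_in_L2_on: "veval q \<in> L2_on {a<..<b}"
proof -
  note set_integrable_poly[of a b "\<Sum>i\<in>UNIV. q $ i * q $ i"]
  also have "poly (\<Sum>i\<in>UNIV. q $ i * q $ i) = (\<lambda>s. (norm (veval q s))\<^sup>2)"
    by (rule ext, subst norm_veval) (simp add: poly_sum power2_eq_square)
  finally have "set_integrable lebesgue {a<..<b} (\<lambda>s. (norm (veval q s))\<^sup>2)" .
  moreover have "set_borel_measurable lebesgue {a<..<b} (veval q)"
    unfolding set_borel_measurable_def
    by (intro borel_measurable_scaleR borel_measurable_indicator)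
       (auto intro!: measurable_completion borel_measurable_continuous_onI continuous_on_veval)
  ultimately show ?thesis by (simp add: L2_on_def)
qed

text \<open>Gives access to the definite description: it is unique by \<open>L2_proj_ex1\<close>,
  and a vector test function splits into its components, so scalar tests suffice.\<close>

lemma L2_proj_eqI:
  assumes "a < b" and v: "v \<in> L2_on {a<..<b}" and q: "vdeg_le m q"
    and eq: "\<And>i w. degree w \<le> m \<Longrightarrow>
      poly_int a b (q $ i * w) = (LINT s:{a<..<b}|lebesgue. v s $ i * poly w s)"
  shows "L2_proj m {a<..<b} v = veval q"
  unfolding L2_proj_def
proof (rule the1_equality[OF L2_proj_ex1[OF assms(1) v]], intro conjI ballI)
  show "veval q \<in> vec_polys m" using q by (auto simp: vec_polys_eq)
  fix w :: "real \<Rightarrow> real^'a" assume "w \<in> vec_polys m"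
  then obtain u where u: "w = veval u" "vdeg_le m u" by (auto simp: vec_polys_eq)
  have "(LINT s:{a<..<b}|lebesgue. v s \<bullet> w s) = vip a b q u"
    unfolding u(1) veval_def[of u] vec_polys_inner_integral[OF L2_on_times_poly_integrable[OF v]]
    using u(2) by (simp add: vip_def eq vdeg_le_def)
  then show "(LINT s:{a<..<b}|lebesgue. veval q s \<bullet> w s) = (LINT s:{a<..<b}|lebesgue. v s \<bullet> w s)"
    by (simp add: vip_eq_integral u(1))
qed

lemma L2_proj_cong:
  assumes "S \<in> sets lebesgue" "\<And>s. s \<in> S \<Longrightarrow> v s = w s"
  shows "L2_proj m S v = L2_proj m S w"
proof -
  have "(LINT s:S|lebesgue. v s \<bullet> u s) = (LINT s:S|lebesgue. w s \<bullet> u s)" for u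
    using assms by (intro set_lebesgue_integral_cong) auto
  then show ?thesis by (simp add: L2_proj_def)
qed

lemma L2_proj_veval:
  assumes "a < b" "\<And>s. s \<in> {a<..<b} \<Longrightarrow> v s = veval y s"
  shows "L2_proj m {a<..<b} v = veval (vproj m a b y)"
proof -
  have "L2_proj m {a<..<b} v = L2_proj m {a<..<b} (veval y)"
    by (rule L2_proj_cong) (auto simp: assms(2))
  also have "\<dots> = veval (vproj m a b y)"
  proof (rule L2_proj_eqI[OF assms(1) veval_in_L2_on vdeg_le_vproj[OF assms(1)]])
    fix i and w :: "real poly" assume "degree w \<le> m"
    from pproj_mult[OF assms(1) this]
    show "poly_int a b (vproj m a b y $ i * w) =
        (LINT s:{a<..<b}|lebesgue. veval y s $ i * poly w s)"
      by (simp add: vproj_def poly_int_def veval_def)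
  qed
  finally show ?thesis .
qed

lemma L2_norm_on_nonneg: "L2_norm_on S v \<ge> 0"
  by (simp add: L2_norm_on_def set_lebesgue_integral_def integral_nonneg_AE)

lemma L2_norm_on_power2: "(L2_norm_on S v)\<^sup>2 = (LINT s:S|lebesgue. (norm (v s))\<^sup>2)"
  unfolding L2_norm_on_def set_lebesgue_integral_def
  by (subst real_sqrt_pow2) (auto intro!: integral_nonneg_AE)

text \<open>The norm bound is Bessel's inequality. As v - g is orthogonal to g, integrating 2 v.g -
  |g|^2 <= |v|^2 leaves the squared norm of g on the left.\<close>

lemma L2_proj_obtain:
  fixes v :: "real \<Rightarrow> real^'m"
  assumes ab: "a < b" and v: "v \<in> L2_on {a<..<b}"
  obtains g where "vdeg_le m g" "L2_proj m {a<..<b} v = veval g"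
    "vip a b g g \<le> (L2_norm_on {a<..<b} v)\<^sup>2"
proof -
  let ?I = "{a<..<b}"
  note vi = L2_on_times_poly_integrable[OF v]
  have "\<exists>q. (\<forall>k\<ge>Suc m. coeff q k = 0) \<and> (\<forall>w. (\<forall>k\<ge>Suc m. coeff w k = 0) \<longrightarrow>
          poly_int a b (q * w) = (LINT s:?I|lebesgue. v s $ i * poly w s))" for i
    by (rule poly_riesz[OF ab]) (simp_all add: distrib_left set_integral_add vi mult.left_commute)
  then obtain q where q: "\<And>i. degree (q i) \<le> m" "\<And>i w. degree w \<le> m \<Longrightarrow>
       poly_int a b (q i * w) = (LINT s:?I|lebesgue. v s $ i * poly w s)"
    unfolding degree_le_iff_coeff by metis
  define g :: "(real poly)^'m" where "g = (\<chi> i. q i)"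
  have g: "vdeg_le m g" using q(1) by (simp add: g_def vdeg_le_def)
  have int: "set_integrable lebesgue ?I (\<lambda>s. 2 * (v s $ i * poly (g $ i) s) - poly (g $ i * g $ i) s)" for i
    by (intro set_integral_diff set_integrable_mult_right vi set_integrable_poly)
  \<comment> \<open>The same number is read once as the integral of v.g and once as that of
    |g|^2.\<close>
  have V: "vip a b g g = (\<Sum>i\<in>UNIV. LINT s:?I|lebesgue. v s $ i * poly (g $ i) s)"
    "vip a b g g = (\<Sum>i\<in>UNIV. poly_int a b (g $ i * g $ i))"
    using q by (simp_all add: g_def vip_def)
  have "(LINT s:?I|lebesgue. 2 * (v s $ i * poly (g $ i) s) - poly (g $ i * g $ i) s)
      = 2 * (LINT s:?I|lebesgue. v s $ i * poly (g $ i) s) - poly_int a b (g $ i * g $ i)" for i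
    unfolding poly_int_def
    by (subst set_integral_diff) (use vi set_integrable_poly in \<open>auto intro: set_integrable_mult_right\<close>)
  then have "2 * vip a b g g - vip a b g g
      = (\<Sum>i\<in>UNIV. LINT s:?I|lebesgue. 2 * (v s $ i * poly (g $ i) s) - poly (g $ i * g $ i) s)"
    by (simp only: sum_subtractf sum_distrib_left[symmetric] V[symmetric])
  also have "\<dots> = (LINT s:?I|lebesgue. \<Sum>i\<in>UNIV. 2 * (v s $ i * poly (g $ i) s) - poly (g $ i * g $ i) s)"
    using int unfolding set_lebesgue_integral_def set_integrable_def scaleR_sum_right
    by (intro Bochner_Integration.integral_sum[symmetric])
  also have "\<dots> \<le> (LINT s:?I|lebesgue. (norm (v s))\<^sup>2)"
  proof (rule set_integral_mono)
    show "set_integrable lebesgue ?I (\<lambda>s. (norm (v s))\<^sup>2)" using v by (simp add: L2_on_def)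
    show "set_integrable lebesgue ?I
        (\<lambda>s. \<Sum>i\<in>UNIV. 2 * (v s $ i * poly (g $ i) s) - poly (g $ i * g $ i) s)"
      using int unfolding set_integrable_def scaleR_sum_right
      by (intro Bochner_Integration.integrable_sum)
    fix s
    have "2 * (x * y) - y * y \<le> x * x" for x y :: real
      using zero_le_square[of "x - y"] by (simp add: algebra_simps)
    then show "(\<Sum>i\<in>UNIV. 2 * (v s $ i * poly (g $ i) s) - poly (g $ i * g $ i) s) \<le> (norm (v s))\<^sup>2"
      unfolding power2_norm_eq_inner inner_vec_def by (intro sum_mono) simp
  qed
  also have "\<dots> = (L2_norm_on ?I v)\<^sup>2" by (simp add: L2_norm_on_power2)
  finally have "vip a b g g \<le> (L2_norm_on ?I v)\<^sup>2" by simp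
  moreover have "L2_proj m ?I v = veval g"
    by (rule L2_proj_eqI[OF ab v g]) (simp add: g_def q)
  ultimately show ?thesis using g that by blast
qed

section \<open>Restriction to cells and properties of partitions\<close>

lemma L2_on_subset:
  assumes "v \<in> L2_on S" "A \<in> sets lebesgue" "A \<subseteq> S"
  shows "v \<in> L2_on A"
proof -
  have "(\<lambda>s. indicator A s *\<^sub>R (indicator S s *\<^sub>R v s)) \<in> borel_measurable lebesgue"
    using assms
    by (intro borel_measurable_scaleR[OF borel_measurable_indicator, of A _ "\<lambda>s. indicator S s *\<^sub>R v s"])
       (auto simp: L2_on_def set_borel_measurable_def)
  also have "(\<lambda>s. indicator A s *\<^sub>R (indicator S s *\<^sub>R v s)) = (\<lambda>s. indicator A s *\<^sub>R v s)"
    using assms(3) by (intro ext) (auto simp: indicator_def)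
  finally show ?thesis
    using assms by (auto simp: L2_on_def set_borel_measurable_def intro: set_integrable_subset)
qed

lemma time_partition_mono:
  assumes "time_partition T N t" "i \<le> j" "j \<le> N"
  shows "t i \<le> t j"
  using assms(2,3)
proof (induction j rule: dec_induct)
  case (step n)
  then have "t n < t (Suc n)" using assms(1) by (simp add: time_partition_def)
  then show ?case using step by simp
qed simp

lemma time_partition_bounds:
  assumes "time_partition T N t" "n \<le> N"
  shows "0 \<le> t n" "t n \<le> T"
  using time_partition_mono[OF assms(1), of 0 n] time_partition_mono[OF assms(1), of n N] assms
  by (auto simp: time_partition_def)

lemma time_partition_cell:
  assumes t: "time_partition T N t" and s: "s \<in> {0..T}" and "N > 0"
  obtains n where "n < N" "s \<in> {t n..t (Suc n)}"
proof -
  have "n \<le> N \<Longrightarrow> n > 0 \<Longrightarrow> s \<le> t n \<Longrightarrow> \<exists>k<n. s \<in> {t k..t (Suc k)}" for n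
  proof (induction n)
    case (Suc n)
    show ?case
    proof (cases "n > 0 \<and> s \<le> t n")
      case True
      then show ?thesis using Suc by (meson Suc_leD less_Suc_eq)
    next
      case False
      then have "t n \<le> s" using s t by (cases "n = 0") (auto simp: time_partition_def)
      then show ?thesis using Suc.prems by auto
    qed
  qed simp
  from this[of N] show ?thesis using assms that by (auto simp: time_partition_def)
qed

text \<open>Open cells are disjoint and omit the nodes. Monotonicity of the integral gives an
  inequality directly, which suffices for the summation of the cell estimates.\<close>

lemma sum_L2_norm_on_cells:
  assumes t: "time_partition T N t" and R: "R \<in> L2_on {0<..<T}" and n: "n \<le> N"
  shows "(\<Sum>k<n. (L2_norm_on (cell t k) R)\<^sup>2) \<le> (L2_norm_on {0<..<t n} R)\<^sup>2"
  using n
proof (induction n)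
  case 0
  then show ?case using t by (simp add: time_partition_def)
next
  case (Suc n)
  let ?f = "\<lambda>s. (norm (R s))\<^sup>2"
  have int: "set_integrable lebesgue A ?f" if "A \<in> sets lebesgue" "A \<subseteq> {0<..<T}" for A
    using L2_on_subset[OF R that] by (simp add: L2_on_def)
  have tn: "0 \<le> t n" "t n \<le> t (Suc n)" "t (Suc n) \<le> T"
    using time_partition_bounds[OF t, of n] time_partition_bounds[OF t, of "Suc n"]
      time_partition_mono[OF t, of n "Suc n"] Suc.prems by auto
  have i: "set_integrable lebesgue {0<..<t n} ?f" "set_integrable lebesgue (cell t n) ?f"
    "set_integrable lebesgue {0<..<t (Suc n)} ?f"
    using tn by (auto intro!: int)
  have "(LINT s:{0<..<t n}|lebesgue. ?f s) + (LINT s:cell t n|lebesgue. ?f s)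
      = (LINT s:{0<..<t n} \<union> cell t n|lebesgue. ?f s)"
    using i by (subst set_integral_Un) auto
  also have "\<dots> \<le> (LINT s:{0<..<t (Suc n)}|lebesgue. ?f s)"
    unfolding set_lebesgue_integral_def
    using i(3) set_integrable_Un[OF i(1,2)] tn
    by (intro integral_mono) (auto simp: set_integrable_def indicator_def)
  finally show ?case
    using Suc by (simp add: L2_norm_on_power2)
qed

text \<open>Reduces the global problem to cell problems. The polynomials represent \<open>Z\<close>
  on closed cells, so neighbours share a node and continuity is encoded by their agreement
  there.\<close>

lemma is_solution_iff:
  assumes t: "time_partition T N t"
    and g: "\<forall>n<N. L2_proj m (cell t n) R = veval (g n)"
  shows "is_solution T N t (Suc m) D Y0 R Z \<longleftrightarrow> Z 0 = Y0 \<and>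
    (\<exists>y. \<forall>n<N. cell_solution m D (t n) (t (Suc n)) (g n) (y n) \<and>
       (\<forall>s\<in>{t n..t (Suc n)}. Z s = veval (y n) s))"
    (is "?L \<longleftrightarrow> _ \<and> ?R")
proof
  assume sol: ?L
  have "\<exists>y. cell_solution m D (t n) (t (Suc n)) (g n) y \<and> (\<forall>s\<in>{t n..t (Suc n)}. Z s = veval y s)"
    if n: "n < N" for n
  proof -
    have ab: "t n < t (Suc n)" using t n by (simp add: time_partition_def)
    obtain y where y: "vdeg_le (Suc m) y" "\<And>s. s \<in> cell t n \<Longrightarrow> Z s = veval y s"
      using sol n by (fastforce simp: is_solution_def V_space_def vec_polys_eq)
    have "vderiv y = vmat D (vproj m (t n) (t (Suc n)) y) + g n"
    \<comment> \<open>Both sides are derivatives of \<open>Z\<close> at interior points; agreement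
      on the open cell forces equality of the polynomials.\<close>
    proof (rule veval_eq_on_interval[OF ab])
      fix s assume "t n < s" "s < t (Suc n)"
      then have s: "s \<in> cell t n" by simp
      have "L2_proj m (cell t n) Z = veval (vproj m (t n) (t (Suc n)) y)"
        by (rule L2_proj_veval[OF ab]) (rule y(2))
      then have "(Z has_vector_derivative D *v veval (vproj m (t n) (t (Suc n)) y) s + veval (g n) s) (at s)"
        using sol n s by (auto simp: is_solution_def g)
      moreover have "(Z has_vector_derivative veval (vderiv y) s) (at s)"
        by (rule has_vector_derivative_transform_within_open[OF has_vector_derivative_veval, where S = "cell t n"])
           (use s y(2) in auto)
      ultimately show "veval (vderiv y) s = veval (vmat D (vproj m (t n) (t (Suc n)) y) + g n) s"
        unfolding veval_add veval_vmat by (rule vector_derivative_unique_at[symmetric])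
    qed
    \<comment> \<open>Continuity of \<open>Z\<close> carries the equality from the open cell to its
      two end nodes.\<close>
    moreover have "Z s = veval y s" if "s \<in> {t n..t (Suc n)}" for s
    proof -
      have "continuous_on {0..T} Z" using sol by (simp add: is_solution_def V_space_def)
      then have "continuous_on {t n..t (Suc n)} Z"
        using time_partition_bounds[OF t, of n] time_partition_bounds[OF t, of "Suc n"] n
        by (auto elim!: continuous_on_subset)
      then have "continuous_on (closure (cell t n)) (\<lambda>s. Z s - veval y s)"
        using ab by (simp add: continuous_on_diff continuous_on_veval)
      then have "Z s - veval y s = 0"
        by (rule continuous_constant_on_closure) (use that ab y(2) in auto)
      then show ?thesis by simp
    qed
    ultimately show ?thesis using y(1) by (auto simp: cell_solution_def)
  qed
  then have ?R by metis
  with sol show "Z 0 = Y0 \<and> ?R" by (simp add: is_solution_def)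
next
  assume "Z 0 = Y0 \<and> ?R"
  then obtain y where Z0: "Z 0 = Y0"
    and y: "\<And>n. n < N \<Longrightarrow> cell_solution m D (t n) (t (Suc n)) (g n) (y n)"
    and Z: "\<And>n s. n < N \<Longrightarrow> s \<in> {t n..t (Suc n)} \<Longrightarrow> Z s = veval (y n) s"
    by metis
  have "continuous_on {0..t n} Z" if "n \<le> N" for n
    using that
  proof (induction n)
    case 0
    then show ?case using t by (simp add: time_partition_def)
  next
    case (Suc n)
    then have "continuous_on {t n..t (Suc n)} Z"
      using Z by (subst continuous_on_cong[OF refl, of _ _ "veval (y n)"])
        (auto intro: continuous_on_veval)
    then have "continuous_on ({0..t n} \<union> {t n..t (Suc n)}) Z"
      using Suc by (intro continuous_on_closed_Un) auto
    moreover have "{0..t n} \<union> {t n..t (Suc n)} = {0..t (Suc n)}"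
      using time_partition_bounds[OF t, of n] time_partition_mono[OF t, of n "Suc n"] Suc.prems
      by auto
    ultimately show ?case by simp
  qed
  from this[of N] have cont: "continuous_on {0..T} Z" using t by (simp add: time_partition_def)
  have V: "Z \<in> V_space T N t (Suc m)"
    unfolding V_space_def mem_Collect_eq vec_polys_eq
    using cont y Z by (fastforce simp: cell_solution_def)
  have "(Z has_vector_derivative
      D *v L2_proj m (cell t n) Z s + L2_proj m (cell t n) R s) (at s)"
    if n: "n < N" and s: "s \<in> cell t n" for n s
  proof -
    have ab: "t n < t (Suc n)" using t n by (simp add: time_partition_def)
    have "L2_proj m (cell t n) Z = veval (vproj m (t n) (t (Suc n)) (y n))"
      using Z[OF n] by (intro L2_proj_veval[OF ab]) simp
    then have "D *v L2_proj m (cell t n) Z s + L2_proj m (cell t n) R s = veval (vderiv (y n)) s"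
      using y[OF n] by (simp add: cell_solution_def g[rule_format, OF n] veval_add veval_vmat)
    moreover have "(Z has_vector_derivative veval (vderiv (y n)) s) (at s)"
      by (rule has_vector_derivative_transform_within_open[OF has_vector_derivative_veval, where S = "cell t n"])
         (use s Z[OF n] in auto)
    ultimately show ?thesis by simp
  qed
  with V Z0 show ?L by (simp add: is_solution_def)
qed

section \<open>Existence, uniqueness and stability over all cells\<close>

lemma is_solution_exists:
  fixes D :: "real^'m^'m"
  assumes t: "time_partition T N t" and D: "neg_semidef (D + transpose D)"
    and g: "\<forall>n<N. vdeg_le m (g n)" "\<forall>n<N. L2_proj m (cell t n) R = veval (g n)"
    and N: "N > 0"
  shows "\<exists>Z. is_solution T N t (Suc m) D Y0 R Z"
proof -
  let ?P = "\<lambda>n x y. cell_solution m D (t n) (t (Suc n)) (g n) y \<and> veval y (t n) = x"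
  define pick where "pick n x = (SOME y. ?P n x y)" for n x
  \<comment> \<open>Time stepping: \<open>x n\<close> is the value at node n, and the polynomial
    picked on cell n with this initial value yields the value at node n + 1.\<close>
  define x where "x = rec_nat Y0 (\<lambda>n x. veval (pick n x) (t (Suc n)))"
  define y where "y n = pick n (x n)" for n
  \<comment> \<open>The least index assigns an interior node to the cell on its left, and 0 to the
    first cell.\<close>
  define Z where "Z s = veval (y (LEAST k. s \<le> t (Suc k))) s" for s
  have y: "cell_solution m D (t n) (t (Suc n)) (g n) (y n)" "veval (y n) (t n) = x n"
    if "n < N" for n
  proof -
    have "\<exists>y. ?P n (x n) y"
      using t that by (intro cell_solution_exists D g(1)[rule_format]) (auto simp: time_partition_def)
    from someI_ex[OF this] show "cell_solution m D (t n) (t (Suc n)) (g n) (y n)"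
      and "veval (y n) (t n) = x n"
      by (simp_all add: y_def pick_def)
  qed
  have x: "x 0 = Y0" "\<And>n. x (Suc n) = veval (y n) (t (Suc n))"
    by (simp_all add: x_def y_def)
  have least: "(LEAST k. s \<le> t (Suc k)) = n"
    if "n < N" "s \<le> t (Suc n)" "t n < s \<or> n = 0" for n s
  proof (rule Least_equality)
    fix k assume k: "s \<le> t (Suc k)"
    show "n \<le> k"
    proof (rule ccontr)
      assume "\<not> n \<le> k"
      then have "t (Suc k) \<le> t n" using that by (intro time_partition_mono[OF t]) auto
      then show False using k that \<open>\<not> n \<le> k\<close> by auto
    qed
  qed (use that in simp)
  have Z: "Z s = veval (y n) s" if n: "n < N" and s: "s \<in> {t n..t (Suc n)}" for n s
  proof (cases "t n < s \<or> n = 0")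
    case True
    then show ?thesis using least[OF n] s by (simp add: Z_def)
  next
    case False
    \<comment> \<open>Only the left end of a later cell remains. There \<open>Z\<close> follows the
      previous polynomial, whose end value is by construction the initial value of
      \<open>y n\<close>.\<close>
    then obtain k where k: "n = Suc k" "s = t (Suc k)" using s by (cases n) auto
    then have "t k < s" using t n by (simp add: time_partition_def)
    then have "Z s = veval (y k) s" using least[of k s] n k by (simp add: Z_def)
    also have "\<dots> = veval (y n) s" using y(2)[OF n] k x(2)[of k] by simp
    finally show ?thesis .
  qed
  have "Z 0 = Y0"
    using Z[OF N, of 0] y(2)[OF N] t N by (auto simp: x time_partition_def less_imp_le)
  then have "is_solution T N t (Suc m) D Y0 R Z"
    unfolding is_solution_iff[OF t g(2)] using y(1) Z by auto
  then show ?thesis by blast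
qed

text \<open>Equal values at the left node of a cell force equal polynomials on it, hence equal
  values at the right node; induction over the nodes covers the whole interval.\<close>

lemma is_solution_unique:
  assumes t: "time_partition T N t" and D: "neg_semidef (D + transpose D)"
    and g: "\<forall>n<N. L2_proj m (cell t n) R = veval (g n)" and N: "N > 0"
    and Y: "is_solution T N t (Suc m) D Y0 R Y" and Z: "is_solution T N t (Suc m) D Y0 R Z"
    and s: "s \<in> {0..T}"
  shows "Z s = Y s"
proof -
  obtain y where y: "\<And>n. n < N \<Longrightarrow> cell_solution m D (t n) (t (Suc n)) (g n) (y n)"
      "\<And>n s. n < N \<Longrightarrow> s \<in> {t n..t (Suc n)} \<Longrightarrow> Y s = veval (y n) s" and Y0: "Y 0 = Y0"
    using Y[unfolded is_solution_iff[OF t g]] by metis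
  obtain z where z: "\<And>n. n < N \<Longrightarrow> cell_solution m D (t n) (t (Suc n)) (g n) (z n)"
      "\<And>n s. n < N \<Longrightarrow> s \<in> {t n..t (Suc n)} \<Longrightarrow> Z s = veval (z n) s" and Z0: "Z 0 = Y0"
    using Z[unfolded is_solution_iff[OF t g]] by metis
  have step: "y n = z n" if "n < N" "Y (t n) = Z (t n)" for n
    using that t y(2)[of n "t n"] z(2)[of n "t n"]
    by (intro cell_solution_unique[OF _ D y(1) z(1)]) (auto simp: time_partition_def less_imp_le)
  have node: "Y (t n) = Z (t n)" if "n \<le> N" for n
    using that
  proof (induction n)
    case 0
    then show ?case using t Y0 Z0 by (simp add: time_partition_def)
  next
    case (Suc n)
    then have "y n = z n" by (intro step) auto
    then show ?case
      using y(2)[of n "t (Suc n)"] z(2)[of n "t (Suc n)"] Suc.prems t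
      by (auto simp: time_partition_def less_imp_le)
  qed
  obtain n where "n < N" "s \<in> {t n..t (Suc n)}" using time_partition_cell[OF t s N] .
  then show ?thesis using y(2)[of n s] z(2)[of n s] step[of n] node[of n] by simp
qed

lemma is_solution_bounds:
  assumes t: "time_partition T N t" and D: "neg_semidef (D + transpose D)"
    and g: "\<forall>n<N. L2_proj m (cell t n) R = veval (g n)" and N: "N > 0"
    and bessel: "\<forall>n<N. vip (t n) (t (Suc n)) (g n) (g n) \<le> (L2_norm_on (cell t n) R)\<^sup>2"
    and R: "R \<in> L2_on {0<..<T}"
    and Y: "is_solution T N t (Suc m) D Y0 R Y"
  defines "B \<equiv> norm Y0 + 2 * (sqrt T * L2_norm_on {0<..<T} R)"
  shows "n \<le> N \<Longrightarrow> norm (Y (t n)) \<le> B"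
    and "s \<in> {0..T} \<Longrightarrow> norm (Y s) \<le> 3 * real (Suc m) * B"
proof -
  obtain y where y: "\<And>n. n < N \<Longrightarrow> cell_solution m D (t n) (t (Suc n)) (g n) (y n)"
      "\<And>n s. n < N \<Longrightarrow> s \<in> {t n..t (Suc n)} \<Longrightarrow> Y s = veval (y n) s" and Y0: "Y 0 = Y0"
    using Y[unfolded is_solution_iff[OF t g]] by metis
  define \<rho> where "\<rho> n = L2_norm_on (cell t n) R" for n
  define \<sigma> where "\<sigma> n = sqrt (t (Suc n) - t n)" for n
  have lt: "t n < t (Suc n)" if "n < N" for n using t that by (simp add: time_partition_def)
  have \<rho>: "\<rho> n \<ge> 0" for n by (simp add: \<rho>_def L2_norm_on_nonneg)
  note cb = cell_solution_bounds[OF lt D y(1) \<rho> bessel[rule_format, folded \<rho>_def], folded \<sigma>_def]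
  have acc: "norm (Y (t n)) \<le> norm Y0 + 2 * (\<Sum>k<n. \<sigma> k * \<rho> k)" if "n \<le> N" for n
    using that
  proof (induction n)
    case 0
    then show ?case using t Y0 by (simp add: time_partition_def)
  next
    case (Suc n)
    then show ?case
      using cb(1)[of n] y(2)[of n "t n"] y(2)[of n "t (Suc n)"] lt[of n]
      by (simp add: algebra_simps less_imp_le)
  qed
  \<comment> \<open>All terms are nonnegative, so the sum may be extended to all cells; in
    Cauchy-Schwarz the squares of \<open>\<sigma>\<close> telescope to \<open>T\<close>.\<close>
  have total: "(\<Sum>k<n. \<sigma> k * \<rho> k) \<le> sqrt T * L2_norm_on {0<..<T} R" if n: "n \<le> N" for n
  proof -
    have "(\<Sum>k<n. \<sigma> k * \<rho> k) \<le> (\<Sum>k<N. \<sigma> k * \<rho> k)"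
      using n lt \<rho> by (intro sum_mono2) (auto simp: \<sigma>_def less_imp_le)
    also have "\<dots> \<le> (\<Sum>k<N. \<bar>\<sigma> k\<bar> * \<bar>\<rho> k\<bar>)"
      by (intro sum_mono) (simp flip: abs_mult)
    also have "\<dots> \<le> L2_set \<sigma> {..<N} * L2_set \<rho> {..<N}" by (rule L2_set_mult_ineq)
    also have "L2_set \<sigma> {..<N} = sqrt T"
    proof -
      have "(\<Sum>k<N. (\<sigma> k)\<^sup>2) = (\<Sum>k<N. t (Suc k) - t k)"
        using lt by (intro sum.cong) (auto simp: \<sigma>_def less_imp_le)
      then show ?thesis using t by (simp add: L2_set_def sum_lessThan_telescope time_partition_def)
    qed
    also have "L2_set \<rho> {..<N} \<le> L2_norm_on {0<..<T} R"
      unfolding L2_set_def \<rho>_def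
      using sum_L2_norm_on_cells[OF t R, of N] t
      by (intro real_le_lsqrt) (auto simp: L2_norm_on_nonneg time_partition_def)
    finally show ?thesis using time_partition_bounds[OF t, of N] by (simp add: mult_left_mono)
  qed
  show "norm (Y (t n)) \<le> B" if "n \<le> N"
    using acc[OF that] total[OF that] by (simp add: B_def)
  assume "s \<in> {0..T}"
  then obtain n where n: "n < N" "s \<in> {t n..t (Suc n)}" using time_partition_cell[OF t _ N] by blast
  \<comment> \<open>The cell bound adds the increment of cell n to the node value, so the sum over n
    + 1 cells covers both and the same \<open>B\<close> serves inside cells.\<close>
  have "norm (veval (y n) (t n)) + 2 * \<sigma> n * \<rho> n \<le> norm Y0 + 2 * (\<Sum>k<Suc n. \<sigma> k * \<rho> k)"
    using acc[of n] n y(2)[of n "t n"] by simp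
  also have "\<dots> \<le> B" using total[of "Suc n"] n by (simp add: B_def)
  finally have "3 * real (Suc m) * (norm (veval (y n) (t n)) + 2 * \<sigma> n * \<rho> n) \<le> 3 * real (Suc m) * B"
    by (rule mult_left_mono) simp
  with cb(2)[OF n(1) n(1) n(1) n(2)] show "norm (Y s) \<le> 3 * real (Suc m) * B"
    unfolding y(2)[OF n] by (rule order_trans)
qed

theorem lemma2p1:
  shows "\<exists>C>0. \<forall>(T::real) (N::nat) (t::nat \<Rightarrow> real) (r::nat)
           (D::real ^ 'm ^ 'm) (Y0::real ^ 'm) (R::real \<Rightarrow> real ^ 'm).
     T > 0 \<and> time_partition T N t \<and> r \<ge> 1 \<and>
     neg_semidef (D + transpose D) \<and> R \<in> L2_on {0<..<T} \<longrightarrow>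
     (\<exists>Y. is_solution T N t r D Y0 R Y \<and>
          (\<forall>Z. is_solution T N t r D Y0 R Z \<longrightarrow> (\<forall>s\<in>{0..T}. Z s = Y s)) \<and>
          (MAX n\<in>{1..N}. norm (Y (t n)))
            \<le> norm Y0 + C * sqrt T * L2_norm_on {0<..<T} R \<and>
          (SUP s\<in>{0..T}. norm (Y s))
            \<le> C * (real r)\<^sup>2 * (norm Y0 + sqrt T * L2_norm_on {0<..<T} R))"
proof (rule exI[of _ 6], intro conjI allI impI)
  fix T :: real and N r :: nat and t :: "nat \<Rightarrow> real"
    and D :: "real^'m^'m" and Y0 :: "real^'m" and R :: "real \<Rightarrow> real^'m"
  assume asm: "T > 0 \<and> time_partition T N t \<and> r \<ge> 1 \<and>
     neg_semidef (D + transpose D) \<and> R \<in> L2_on {0<..<T}"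
  then have T: "T > 0" and t: "time_partition T N t" and D: "neg_semidef (D + transpose D)"
    and R: "R \<in> L2_on {0<..<T}" by auto
  obtain m where r: "r = Suc m" using asm by (cases r) auto
  \<comment> \<open>A positive \<open>T\<close> requires at least one cell, so the maximum over
    nodes ranges over a nonempty set.\<close>
  have N: "N > 0" using T t by (cases N) (auto simp: time_partition_def)
  define K where "K = sqrt T * L2_norm_on {0<..<T} R"
  have K: "K \<ge> 0" using T by (simp add: K_def L2_norm_on_nonneg)
  have "\<exists>h. vdeg_le m h \<and> L2_proj m (cell t n) R = veval h \<and>
      vip (t n) (t (Suc n)) h h \<le> (L2_norm_on (cell t n) R)\<^sup>2" if n: "n < N" for n
  proof -
    have "R \<in> L2_on (cell t n)"
      using time_partition_bounds[OF t, of n] time_partition_bounds[OF t, of "Suc n"] n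
      by (intro L2_on_subset[OF R]) auto
    moreover have "t n < t (Suc n)" using t n by (simp add: time_partition_def)
    ultimately show ?thesis using L2_proj_obtain by metis
  qed
  then obtain g where g: "\<forall>n<N. vdeg_le m (g n)"
      "\<forall>n<N. L2_proj m (cell t n) R = veval (g n)"
      "\<forall>n<N. vip (t n) (t (Suc n)) (g n) (g n) \<le> (L2_norm_on (cell t n) R)\<^sup>2"
    by metis
  obtain Y where Y: "is_solution T N t (Suc m) D Y0 R Y"
    using is_solution_exists[OF t D g(1,2) N] by blast
  note bounds = is_solution_bounds[OF t D g(2) N g(3) R Y, folded K_def]
  show "\<exists>Y. is_solution T N t r D Y0 R Y \<and>
          (\<forall>Z. is_solution T N t r D Y0 R Z \<longrightarrow> (\<forall>s\<in>{0..T}. Z s = Y s)) \<and>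
          (MAX n\<in>{1..N}. norm (Y (t n)))
            \<le> norm Y0 + 6 * sqrt T * L2_norm_on {0<..<T} R \<and>
          (SUP s\<in>{0..T}. norm (Y s))
            \<le> 6 * (real r)\<^sup>2 * (norm Y0 + sqrt T * L2_norm_on {0<..<T} R)"
    unfolding mult.assoc K_def[symmetric]
  proof (intro exI[of _ Y] conjI allI impI ballI)
    show "is_solution T N t r D Y0 R Y" using Y by (simp add: r)
  next
    fix Z s assume "is_solution T N t r D Y0 R Z" "s \<in> {0..T}"
    then show "Z s = Y s" using is_solution_unique[OF t D g(2) N Y] by (simp add: r)
  next
    have "norm (Y (t n)) \<le> norm Y0 + 6 * K" if "n \<le> N" for n
      using bounds(1)[OF that] K by simp
    then show "(MAX n\<in>{1..N}. norm (Y (t n))) \<le> norm Y0 + 6 * K"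
      using N by (intro Max.boundedI) auto
  next
    \<comment> \<open>The constant 6 is 3 times 2: the factor 3 comes from the cell maximum, the
      factor 2 from the data term. The bound is linear in \<open>r\<close> until r <= r^2 is
      applied.\<close>
    have "norm (Y s) \<le> 6 * ((real r)\<^sup>2 * (norm Y0 + K))" if "s \<in> {0..T}" for s
    proof -
      have "norm (Y s) \<le> 3 * real r * (norm Y0 + 2 * K)"
        using bounds(2)[OF that] by (simp add: r)
      also have "\<dots> \<le> 3 * real r * (2 * (norm Y0 + K))" by (intro mult_left_mono) auto
      also have "\<dots> = 6 * (real r * (norm Y0 + K))" by simp
      also have "\<dots> \<le> 6 * ((real r)\<^sup>2 * (norm Y0 + K))"
        using K by (intro mult_left_mono mult_right_mono) (auto simp: r power2_eq_square)
      finally show ?thesis .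
    qed
    then show "(SUP s\<in>{0..T}. norm (Y s)) \<le> 6 * ((real r)\<^sup>2 * (norm Y0 + K))"
      using T by (intro cSUP_least) auto
  qed
qed simp

end
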